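(* Let $\mathbb F$ be a field, $A$ a finite-dimensional $\mathbb F$-algebra, and $(\sigma,\delta)$ a left skew derivation of $A$ such that $\sigma$ is an $\mathbb F$-algebra automorphism and $\delta$ is $\mathbb F$-linear, with both $\delta$ and $\delta'=-\delta\sigma^{-1}$ nilpotent. Let $\mathbb F^n$ be endowed with a right $A$-module structure. Then the map $\mathcal D\mapsto\mathcal D\cap\mathbb F^n[X]$ is a bijection between the set of all $(\sigma,\delta,A)$-cyclic convolutional codes of rate $k/n$ and the set of all right $A[X;\sigma,\delta]$-submodules of $\mathbb F^n[X]$ that are $\mathbb F[X]$-direct summands of rank $k$ of $\mathbb F^n[X]$.
   Context: Rings are associative and unital. A left skew derivation of $A$ is a pair $(\sigma,\delta)$ where $\sigma$ is a ring endomorphism of $A$ and $\delta:A\to A$ is additive with $\delta(ab)=\sigma(a)\delta(b)+\delta(a)b$. $A[X;\sigma,\delta]$ is the skew polynomial ring: free left $A$-module with basis $\{X^i:i\in\mathbb N\}$ and product determined by $X^iX^j=X^{i+j}$, $Xa=\sigma(a)X+\delta(a)$. For a module $M$, $M[X]$, $M[\![X]\!]$, $M(\!(X)\!)$ denote polynomials $\sum_{i=0}^nm_iX^i$, power series $\sum_{i\ge0}m_iX^i$ and Laurent series $\sum_{i\ge i_0}m_iX^i$ ($i_0\in\mathbb Z$) with coefficients in $M$. For an additive map $L:A\to A$ and $s=\sum_is_iX^i$, $L(s)=\sum_iL(s_i)X^i$. $[f]_n$ or $(f)_n$ is the coefficient of $X^n$ in $f$. Ring $A(\!(X;\sigma,\delta)\!)$: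 put $\sigma'=\sigma^{-1}$ and let $m\ge1$ with $\delta^m=\delta'^m=0$. For $a\in A$, $n\in\mathbb N$ let $O_n(a)$ be a natural number such that $(X^ja)_i=0$ in $A[X;\sigma,\delta]$ whenever $i\le n$, $j\ge O_n(a)$ (it exists). There is a unique ring structure on the additive group $A(\!(X)\!)$, denoted $A(\!(X;\sigma,\delta)\!)$, containing $A[X;\sigma,\delta]$ as a subring and such that, for $s,t\in A[\![X]\!]$, $\ell\in\mathbb Z$ and $q_n\ge\max_{0\le i\le n}O_n(t_i)$: $sX^\ell=\sum_{i\ge0}s_iX^{i+\ell}$; $st=\sum_{n\ge0}\left[\left(\sum_{i=0}^{q_n}s_iX^i\right)\left(\sum_{i=0}^nt_iX^i\right)\right]_nX^n$; $X^{-1}s=\sum_{k=0}^m\sigma'\delta'^k(s)X^{-1-k}$. Modules: for a finite-dimensional right $A$-module $M$, the canonical additive isomorphism $M\otimes_AA(\!(X;\sigma,\delta)\!)\to M(\!(X)\!)$, $y\otimes\sum_is_iX^i\mapsto\sum_iys_iX^i$, transfers a right $A(\!(X;\sigma,\delta)\!)$-module structure to $M(\!(X)\!)$; $M[X]$ is a right $A[X;\sigma,\delta]$-submodule (with the structure coming from $M[X]\cong M\otimes_AA[X;\sigma,\delta]$). By restriction $M(\!(X)\!)$ is a right $A$-module and a vector space over the subfield $\mathbb F(\!(X)\!)$ of $A(\!(X;\sigma,\delta)\!)$, the latter structure being the usual one, $\left(\sum_is_iX^i\right)\left(\sum_jt_jX^j\right)=\sum_k\left(\sum_{i+j=k}s_it_j\right)X^k$.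 This is applied to $M=\mathbb F^n$, whose given right $A$-module structure restricts to the usual $\mathbb F$-vector space structure. A convolutional code of rate $k/n$ is a $k$-dimensional $\mathbb F(\!(X)\!)$-vector subspace of $\mathbb F^n(\!(X)\!)$ having a basis consisting of vectors in $\mathbb F^n[X]$. It is $(\sigma,\delta,A)$-cyclic if it is a right $A$-submodule of $\mathbb F^n(\!(X)\!)$. *)

theory Defs
  imports
    "HOL-Analysis.Finite_Cartesian_Product"
    "HOL-Computational_Algebra.Formal_Laurent_Series"
begin

no_notation fps_nth (infixl \<open>$\<close> 75)
notation fls_nth (infixl \<open>$$\<close> 75)

section \<open>Skew derivations and finite-dimensional algebras\<close>

definition left_skew_derivation :: "('a::ring_1 \<Rightarrow> 'a) \<Rightarrow> ('a \<Rightarrow> 'a) \<Rightarrow> bool" where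
  "left_skew_derivation \<sigma> \<delta> \<longleftrightarrow>
     (\<forall>a b. \<sigma> (a + b) = \<sigma> a + \<sigma> b) \<and> (\<forall>a b. \<sigma> (a * b) = \<sigma> a * \<sigma> b) \<and> \<sigma> 1 = 1 \<and>
     (\<forall>a b. \<delta> (a + b) = \<delta> a + \<delta> b) \<and> (\<forall>a b. \<delta> (a * b) = \<sigma> a * \<delta> b + \<delta> a * b)"

definition twisted_derivation :: "('a::ring_1 \<Rightarrow> 'a) \<Rightarrow> ('a \<Rightarrow> 'a) \<Rightarrow> 'a \<Rightarrow> 'a" where
  "twisted_derivation \<sigma> \<delta> = (\<lambda>a. - \<delta> (inv \<sigma> a))"

definition nilpotent_map :: "('a::zero \<Rightarrow> 'a) \<Rightarrow> bool" where
  "nilpotent_map f \<longleftrightarrow> (\<exists>m. f ^^ m = (\<lambda>_. 0))"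

definition finite_dim_algebra :: "('f::field \<Rightarrow> 'a::ring_1 \<Rightarrow> 'a) \<Rightarrow> bool" where
  "finite_dim_algebra scl \<longleftrightarrow>
     vector_space scl \<and>
     (\<forall>c a b. scl c (a * b) = scl c a * b \<and> scl c (a * b) = a * scl c b) \<and>
     (\<exists>B. finite B \<and> module.span scl B = UNIV)"

definition algebra_automorphism :: "('f::field \<Rightarrow> 'a::ring_1 \<Rightarrow> 'a) \<Rightarrow> ('a \<Rightarrow> 'a) \<Rightarrow> bool" where
  "algebra_automorphism scl \<sigma> \<longleftrightarrow>
     Vector_Spaces.linear scl scl \<sigma> \<and> (\<forall>a b. \<sigma> (a * b) = \<sigma> a * \<sigma> b) \<and> \<sigma> 1 = 1 \<and> bij \<sigma>"

text \<open>The ring acting on the right is given by its multiplication and its unit, because the skew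
  Laurent series ring lives on a type which carries another multiplication.\<close>

definition right_module :: "('r::ab_group_add \<Rightarrow> 'r \<Rightarrow> 'r) \<Rightarrow> 'r \<Rightarrow> ('m::ab_group_add \<Rightarrow> 'r \<Rightarrow> 'm) \<Rightarrow> bool"
  where
  "right_module mul e act \<longleftrightarrow>
     (\<forall>x y a. act (x + y) a = act x a + act y a) \<and>
     (\<forall>x a b. act x (a + b) = act x a + act x b) \<and>
     (\<forall>x a b. act x (mul a b) = act (act x a) b) \<and>
     (\<forall>x. act x e = x)"

text \<open>\<open>S\<close> is the subring whose action is considered.\<close>

definition right_submodule :: "'r set \<Rightarrow> ('m::ab_group_add \<Rightarrow> 'r \<Rightarrow> 'm) \<Rightarrow> 'm set \<Rightarrow> bool" where
  "right_submodule S act N \<longleftrightarrow>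
     0 \<in> N \<and> (\<forall>x\<in>N. \<forall>y\<in>N. x + y \<in> N) \<and> (\<forall>x\<in>N. - x \<in> N) \<and> (\<forall>x\<in>N. \<forall>a\<in>S. act x a \<in> N)"


section \<open>The skew polynomial ring\<close>

text \<open>The underlying additive group is \<^typ>\<open>'a poly\<close>.  The first function is the left
  multiplication by \<open>X\<close>, obtained from \<open>X a = \<sigma>(a) X + \<delta>(a)\<close>.\<close>

definition skew_poly_X :: "('a::ring_1 \<Rightarrow> 'a) \<Rightarrow> ('a \<Rightarrow> 'a) \<Rightarrow> 'a poly \<Rightarrow> 'a poly" where
  "skew_poly_X \<sigma> \<delta> p = pCons 0 (map_poly \<sigma> p) + map_poly \<delta> p"

definition skew_poly_mult :: "('a::ring_1 \<Rightarrow> 'a) \<Rightarrow> ('a \<Rightarrow> 'a) \<Rightarrow> 'a poly \<Rightarrow> 'a poly \<Rightarrow> 'a poly" where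
  "skew_poly_mult \<sigma> \<delta> p q =
     (\<Sum>i\<le>degree p. map_poly (\<lambda>b. coeff p i * b) ((skew_poly_X \<sigma> \<delta> ^^ i) q))"

text \<open>\<open>N\<close> is an admissible choice for the number \<open>O\<^sub>n(a)\<close>.\<close>

definition skew_bound :: "('a::ring_1 \<Rightarrow> 'a) \<Rightarrow> ('a \<Rightarrow> 'a) \<Rightarrow> nat \<Rightarrow> 'a \<Rightarrow> nat \<Rightarrow> bool" where
  "skew_bound \<sigma> \<delta> n a N \<longleftrightarrow>
     (\<forall>i\<le>n. \<forall>j\<ge>N. coeff (skew_poly_mult \<sigma> \<delta> (monom 1 j) [:a:]) i = 0)"


section \<open>The skew Laurent series ring\<close>

text \<open>The underlying additive group is \<^typ>\<open>'a fls\<close>; polynomials and power series are embedded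
  by the following function and by \<^const>\<open>fps_to_fls\<close>.\<close>

definition fls_of_poly :: "'a::zero poly \<Rightarrow> 'a fls" where
  "fls_of_poly p = fps_to_fls (fps_of_poly p)"

definition fps_trunc :: "nat \<Rightarrow> 'a::comm_monoid_add fps \<Rightarrow> 'a poly" where
  "fps_trunc q s = (\<Sum>i\<le>q. monom (fps_nth s i) i)"

definition fps_map :: "('a \<Rightarrow> 'b) \<Rightarrow> 'a fps \<Rightarrow> 'b fps" where
  "fps_map L s = Abs_fps (\<lambda>i. L (fps_nth s i))"

definition is_skew_laurent_mult ::
  "('a::ring_1 \<Rightarrow> 'a) \<Rightarrow> ('a \<Rightarrow> 'a) \<Rightarrow> ('a fls \<Rightarrow> 'a fls \<Rightarrow> 'a fls) \<Rightarrow> bool" where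
  "is_skew_laurent_mult \<sigma> \<delta> mul \<longleftrightarrow>
     \<comment> \<open>\<open>mul\<close> is a ring multiplication with unit 1, extending that of the skew polynomial ring\<close>
     (\<forall>s t u. mul (mul s t) u = mul s (mul t u)) \<and>
     (\<forall>s t u. mul (s + t) u = mul s u + mul t u) \<and>
     (\<forall>s t u. mul s (t + u) = mul s t + mul s u) \<and>
     (\<forall>s. mul 1 s = s \<and> mul s 1 = s) \<and>
     (\<forall>p q. mul (fls_of_poly p) (fls_of_poly q) = fls_of_poly (skew_poly_mult \<sigma> \<delta> p q)) \<and>
     \<comment> \<open>right multiplication of a power series by \<open>X\<^sup>l\<close>; \<^term>\<open>fls_shift (- l)\<close> shifts upwards by \<open>l\<close>\<close>
     (\<forall>s l. mul (fps_to_fls s) (fls_X_intpow l) = fls_shift (- l) (fps_to_fls s)) \<and>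
     \<comment> \<open>product of two power series\<close>
     (\<forall>s t q. (\<forall>n. \<forall>i\<le>n. skew_bound \<sigma> \<delta> n (fps_nth t i) (q n)) \<longrightarrow>
        mul (fps_to_fls s) (fps_to_fls t) =
          fps_to_fls (Abs_fps (\<lambda>n. coeff (skew_poly_mult \<sigma> \<delta> (fps_trunc (q n) s) (fps_trunc n t)) n))) \<and>
     \<comment> \<open>left multiplication of a power series by \<open>X\<^sup>-\<^sup>1\<close>\<close>
     (\<forall>m s. m \<ge> 1 \<and> \<delta> ^^ m = (\<lambda>_. 0) \<and> twisted_derivation \<sigma> \<delta> ^^ m = (\<lambda>_. 0) \<longrightarrow>
        mul fls_X_inv (fps_to_fls s) =
          (\<Sum>k=0..m. fls_shift (1 + int k)
             (fps_to_fls (fps_map (\<lambda>a. inv \<sigma> ((twisted_derivation \<sigma> \<delta> ^^ k) a)) s))))"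

definition skew_laurent_mult ::
  "('a::ring_1 \<Rightarrow> 'a) \<Rightarrow> ('a \<Rightarrow> 'a) \<Rightarrow> 'a fls \<Rightarrow> 'a fls \<Rightarrow> 'a fls" where
  "skew_laurent_mult \<sigma> \<delta> = (THE mul. is_skew_laurent_mult \<sigma> \<delta> mul)"

text \<open>The image of \<open>y \<otimes> s\<close> under the canonical isomorphism from \<open>M \<otimes>\<^sub>A A((X;\<sigma>,\<delta>))\<close>
  to \<open>M((X))\<close>.\<close>

definition fls_tensor :: "('m::zero \<Rightarrow> 'a::zero \<Rightarrow> 'm) \<Rightarrow> 'm \<Rightarrow> 'a fls \<Rightarrow> 'm fls" where
  "fls_tensor ract y s = Abs_fls (\<lambda>i. ract y (s $$ i))"

text \<open>The module structure transferred along the canonical isomorphism: on the tensor product the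
  action is additive and satisfies \<open>(y \<otimes> s) t = y \<otimes> (s t)\<close>.\<close>

definition is_laurent_act ::
  "('a::ring_1 \<Rightarrow> 'a) \<Rightarrow> ('a \<Rightarrow> 'a) \<Rightarrow> ('m::ab_group_add \<Rightarrow> 'a \<Rightarrow> 'm) \<Rightarrow>
    ('m fls \<Rightarrow> 'a fls \<Rightarrow> 'm fls) \<Rightarrow> bool" where
  "is_laurent_act \<sigma> \<delta> ract act \<longleftrightarrow>
     right_module (skew_laurent_mult \<sigma> \<delta>) 1 act \<and>
     (\<forall>y s t. act (fls_tensor ract y s) t = fls_tensor ract y (skew_laurent_mult \<sigma> \<delta> s t))"

definition laurent_act ::
  "('a::ring_1 \<Rightarrow> 'a) \<Rightarrow> ('a \<Rightarrow> 'a) \<Rightarrow> ('m::ab_group_add \<Rightarrow> 'a \<Rightarrow> 'm) \<Rightarrow> 'm fls \<Rightarrow> 'a fls \<Rightarrow> 'm fls"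
  where
  "laurent_act \<sigma> \<delta> ract = (THE act. is_laurent_act \<sigma> \<delta> ract act)"


section \<open>Existence and uniqueness of these structures\<close>

text \<open>The product is \<open>s t = \<Sum>\<^sub>j s\<^sub>j (X\<^sup>j t)\<close>, where the left multiplications by \<open>X\<close> and by its
  inverse are the maps \<open>T\<close> and \<open>U\<close> below.  The functions involved are raw coefficient functions.\<close>

locale skew_data =
  fixes \<sigma> \<delta> :: "'a::ring_1 \<Rightarrow> 'a" and m :: nat
  assumes der: "left_skew_derivation \<sigma> \<delta>"
    and bij: "bij \<sigma>"
    and nil: "\<delta> ^^ m = (\<lambda>_. 0)"
    and nil': "twisted_derivation \<sigma> \<delta> ^^ m = (\<lambda>_. 0)"
begin

abbreviation \<sigma>' where "\<sigma>' \<equiv> inv \<sigma>"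
abbreviation \<delta>' where "\<delta>' \<equiv> twisted_derivation \<sigma> \<delta>"

lemma sigma_add: "\<sigma> (a + b) = \<sigma> a + \<sigma> b" and sigma_mult: "\<sigma> (a * b) = \<sigma> a * \<sigma> b"
  and sigma_1 [simp]: "\<sigma> 1 = 1" and delta_add: "\<delta> (a + b) = \<delta> a + \<delta> b"
  and delta_mult: "\<delta> (a * b) = \<sigma> a * \<delta> b + \<delta> a * b"
  using der by (auto simp: left_skew_derivation_def)

sublocale s: additive \<sigma> by standard (rule sigma_add)
sublocale d: additive \<delta> by standard (rule delta_add)

lemma sigma_inv [simp]: "\<sigma> (\<sigma>' a) = a" and inv_sigma [simp]: "\<sigma>' (\<sigma> a) = a"
  using bij by (simp_all add: bij_is_surj surj_f_inv_f bij_is_inj)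

sublocale s': additive \<sigma>'
proof
  fix a b show "\<sigma>' (a + b) = \<sigma>' a + \<sigma>' b"
    by (metis sigma_add sigma_inv inv_sigma)
qed

sublocale d': additive \<delta>'
  by standard (simp add: twisted_derivation_def s'.add d.add)

declare s.zero [simp] d.zero [simp] s'.zero [simp] d'.zero [simp]

lemma delta_1 [simp]: "\<delta> 1 = 0"
  using delta_mult[of 1 1] by simp

lemma delta_sigma': "\<delta> (\<sigma>' a) = - \<delta>' a"
  by (simp add: twisted_derivation_def)

lemma d'_pow_add: "(\<delta>' ^^ k) (a + b) = (\<delta>' ^^ k) a + (\<delta>' ^^ k) b"
  by (induction k) (auto simp: d'.add)

lemma d'_pow_0 [simp]: "(\<delta>' ^^ k) 0 = 0"
  by (induction k) auto

lemma d_pow_0 [simp]: "(\<delta> ^^ k) 0 = 0"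
  by (induction k) auto

definition T :: "(int \<Rightarrow> 'a) \<Rightarrow> int \<Rightarrow> 'a" where
  "T f n = \<sigma> (f (n - 1)) + \<delta> (f n)"

definition U :: "(int \<Rightarrow> 'a) \<Rightarrow> int \<Rightarrow> 'a" where
  "U f n = (\<Sum>k<Suc m. \<sigma>' ((\<delta>' ^^ k) (f (n + 1 + int k))))"

lemma d'_pow_big: "(\<delta>' ^^ Suc m) a = 0"
  by (simp add: nil')

lemma T_U: "T (U f) = f"
proof
  fix n
  let ?g = "\<lambda>k. (\<delta>' ^^ k) (f (n + int k))"
  have "\<sigma> (U f (n - 1)) = (\<Sum>k<Suc m. ?g k)"
    unfolding U_def s.sum by (simp del: sum.lessThan_Suc)
  moreover have "\<delta> (U f n) = - (\<Sum>k<Suc m. ?g (Suc k))"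
    unfolding U_def d.sum by (simp add: delta_sigma' sum_negf add_ac del: sum.lessThan_Suc)
  moreover have "(\<Sum>k<Suc m. ?g k) - (\<Sum>k<Suc m. ?g (Suc k)) = ?g 0 - ?g (Suc m)"
    using sum_lessThan_telescope'[of ?g "Suc m"] by (simp only: sum_subtractf)
  ultimately show "T (U f) n = f n"
    unfolding T_def d'_pow_big by (simp del: sum.lessThan_Suc funpow.simps)
qed

lemma U_T: "U (T f) = f"
proof
  fix n
  let ?g = "\<lambda>k. \<sigma>' ((\<delta>' ^^ k) (\<sigma> (f (n + int k))))"
  have "\<delta> a = - \<delta>' (\<sigma> a)" for a by (simp add: twisted_derivation_def)
  then have e: "(\<delta>' ^^ k) (\<delta> a) = - (\<delta>' ^^ Suc k) (\<sigma> a)" for k a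
    by (induction k) (auto simp: d'.minus)
  have "U (T f) n = (\<Sum>k<Suc m. ?g k) - (\<Sum>k<Suc m. ?g (Suc k))"
    unfolding U_def T_def d'_pow_add s'.add e sum.distrib
    by (simp add: s'.minus sum_negf algebra_simps del: sum.lessThan_Suc funpow.simps)
  also have "\<dots> = ?g 0 - ?g (Suc m)"
    using sum_lessThan_telescope'[of ?g "Suc m"] by (simp only: sum_subtractf)
  finally show "U (T f) n = f n"
    using d'_pow_big by simp
qed

definition P :: "int \<Rightarrow> (int \<Rightarrow> 'a) \<Rightarrow> int \<Rightarrow> 'a" where
  "P j f = (if j \<ge> 0 then (T ^^ nat j) f else (U ^^ nat (- j)) f)"

lemma P_0 [simp]: "P 0 f = f"
  by (simp add: P_def)

lemma P_Suc: "P (j + 1) f = T (P j f)"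
proof (cases "j \<ge> 0")
  case True then show ?thesis by (simp add: P_def nat_add_distrib)
next
  case False
  then have "nat (- j) = Suc (nat (- (j + 1)))" by simp
  then have "P j f = U (P (j + 1) f)" using False by (auto simp: P_def)
  then show ?thesis by (simp add: T_U)
qed

lemma P_pred: "P (j - 1) f = U (P j f)"
  using P_Suc[of "j - 1" f] by (simp add: U_T)

lemma T_add: "T (\<lambda>n. f n + g n) = (\<lambda>n. T f n + T g n)"
  by (simp add: T_def s.add d.add fun_eq_iff add_ac)

lemma U_add: "U (\<lambda>n. f n + g n) = (\<lambda>n. U f n + U g n)"
  by (rule ext) (simp only: U_def d'_pow_add s'.add sum.distrib)

lemma P_add: "P j (\<lambda>n. f n + g n) = (\<lambda>n. P j f n + P j g n)"
proof (induction j rule: int_induct[where k = 0])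
  case (step1 j) then show ?case by (simp add: P_Suc T_add)
next
  case (step2 j) then show ?case by (simp add: P_pred U_add)
qed simp

lemma P_zero [simp]: "P j (\<lambda>_. 0) = (\<lambda>_. 0)"
  using P_add[of j "\<lambda>_. 0" "\<lambda>_. 0"] by (simp add: fun_eq_iff)

lemma P_sum: "finite I \<Longrightarrow> P j (\<lambda>n. \<Sum>i\<in>I. F i n) = (\<lambda>n. \<Sum>i\<in>I. P j (F i) n)"
  by (induction I rule: finite_induct) (auto simp: P_add)

lemma P_shift: "P j (\<lambda>n. f (n + l)) n = P j f (n + l)"
proof (induction j arbitrary: n rule: int_induct[where k = 0])
  case (step1 j)
  have "n - 1 + l = n + l - 1" by simp
  then show ?case unfolding P_Suc T_def step1(2) by (simp only:)
next
  case (step2 j)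
  have "n + 1 + int k + l = n + l + 1 + int k" for k by simp
  then show ?case unfolding P_pred U_def step2(2) by (simp only:)
qed simp

abbreviation e :: "int \<Rightarrow> int \<Rightarrow> 'a" where "e l \<equiv> \<lambda>n. if n = l then 1 else 0"

lemma T_e: "T (e l) = e (l + 1)"
  by (auto simp: T_def fun_eq_iff)

lemma U_e: "U (e l) = e (l - 1)"
  using U_T[of "e (l - 1)"] T_e[of "l - 1"] by simp

lemma P_e: "P j (e l) = e (l + j)"
proof (induction j rule: int_induct[where k = 0])
  case (step1 j) then show ?case by (simp only: P_Suc T_e add.assoc)
next
  case (step2 j) then show ?case by (simp only: P_pred U_e add_diff_eq)
qed simp

lemma P_lower:
  assumes "\<forall>n<L. f n = 0" "n < L - int (Suc m) * int (nat (- j))"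
  shows "P j f n = 0"
  using assms(2)
proof (induction j arbitrary: n rule: int_induct[where k = 0])
  case base then show ?case using assms(1) by simp
next
  case (step1 j) then show ?case by (simp add: P_Suc T_def)
next
  case (step2 j)
  have "nat (- (j - 1)) = Suc (nat (- j))" using step2 by simp
  then have "P j f (n + 1 + int k) = 0" if "k < Suc m" for k
    using step2(2,3) that by (intro step2(2)) (simp add: algebra_simps)
  then show ?case by (simp add: P_pred U_def del: sum.lessThan_Suc)
qed

lemma P_lower_ex:
  assumes "\<exists>L. \<forall>n<L. f n = 0"
  obtains L where "\<And>j n. j \<ge> j0 \<Longrightarrow> n < L \<Longrightarrow> P j f n = 0"
proof -
  obtain L where L: "\<forall>n<L. f n = 0" using assms by blast
  show ?thesis
  proof (rule that[of "L - int (Suc m) * int (nat (- j0))"])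
    fix j n assume a: "j \<ge> j0" "n < L - int (Suc m) * int (nat (- j0))"
    have "int (Suc m) * int (nat (- j)) \<le> int (Suc m) * int (nat (- j0))"
      using a by (intro mult_left_mono) auto
    then show "P j f n = 0" using a by (intro P_lower[OF L]) linarith
  qed
qed

lemma T_vanish:
  assumes "\<forall>n<L. f n = 0" "n < L + int i" "j \<ge> i * m"
  shows "(T ^^ j) f n = 0"
  using assms(2,3)
proof (induction i arbitrary: n j)
  case 0
  have "P (int j) f n = 0" using P_lower[OF assms(1), of n "int j"] 0 by simp
  then show ?case by (simp add: P_def)
next
  case (Suc i)
  have "(T ^^ (k + (j - m))) f n = (\<delta> ^^ k) ((T ^^ (j - m)) f n)" for k
  proof (induction k)
    case (Suc k)
    have "(T ^^ (k + (j - m))) f (n - 1) = 0"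
      using Suc.prems \<open>j \<ge> Suc i * m\<close> \<open>n < L + int (Suc i)\<close> by (intro Suc.IH \<open>\<And>n j. n < L + int i \<Longrightarrow> i * m \<le> j \<Longrightarrow> (T ^^ j) f n = 0\<close>) auto
    moreover have "(T ^^ (Suc k + (j - m))) f n = T ((T ^^ (k + (j - m))) f) n" by simp
    moreover have "T h n = \<sigma> (h (n - 1)) + \<delta> (h n)" for h by (rule T_def)
    ultimately show ?case using Suc.IH by simp
  qed simp
  from this[of m] show ?case using Suc.prems by (simp add: nil)
qed

lemma P_vanish_ex:
  assumes "\<exists>L. \<forall>n<L. f n = 0"
  obtains J where "\<And>j n. j \<ge> J \<Longrightarrow> n \<le> N \<Longrightarrow> P j f n = 0"
proof -
  obtain L where L: "\<forall>n<L. f n = 0" using assms by blast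
  define i where "i = nat (N - L + 1)"
  show ?thesis
  proof (rule that[of "int (i * m)"])
    fix j n assume "j \<ge> int (i * m)" "n \<le> N"
    moreover from this have "j \<ge> 0" by (meson of_nat_0_le_iff order_trans)
    ultimately show "P j f n = 0"
      using T_vanish[OF L, of n i "nat j"] by (simp add: P_def i_def le_nat_iff)
  qed
qed

definition E :: "('m::ab_group_add \<Rightarrow> 'a \<Rightarrow> 'm) \<Rightarrow> (int \<Rightarrow> 'm) \<Rightarrow> (int \<Rightarrow> 'a) \<Rightarrow> int \<Rightarrow> 'm" where
  "E r g f n = (\<Sum>j\<in>{j. g j \<noteq> 0 \<and> P j f n \<noteq> 0}. r (g j) (P j f n))"

context
  fixes r :: "'m::ab_group_add \<Rightarrow> 'a \<Rightarrow> 'm"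
  assumes r: "right_module (*) 1 r"
begin

lemma r_add_left: "r (x + y) a = r x a + r y a" and r_add_right: "r x (a + b) = r x a + r x b"
  and r_mult: "r x (a * b) = r (r x a) b" and r_1: "r x 1 = x"
  using r by (auto simp: right_module_def)

lemma r_0_left: "r 0 a = 0" and r_0_right: "r x 0 = 0"
  using r_add_left[of 0 0 a] r_add_right[of x 0 0] by auto

lemma r_sum_left: "r (\<Sum>i\<in>I. f i) a = (\<Sum>i\<in>I. r (f i) a)"
  by (induction I rule: infinite_finite_induct) (auto simp: r_0_left r_add_left)

lemma r_sum_right: "r x (\<Sum>i\<in>I. f i) = (\<Sum>i\<in>I. r x (f i))"
  by (induction I rule: infinite_finite_induct) (auto simp: r_0_right r_add_right)

lemma E_eq:
  assumes "finite J" "\<And>j. j \<notin> J \<Longrightarrow> g j = 0 \<or> P j f n = 0"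
  shows "E r g f n = (\<Sum>j\<in>J. r (g j) (P j f n))"
  unfolding E_def using assms
  by (intro sum.mono_neutral_left) (auto simp: r_0_left r_0_right)

lemma E_range:
  assumes "\<exists>L. \<forall>n<L. g n = 0" "\<exists>L. \<forall>n<L. f n = 0"
  shows "\<forall>\<^sub>F B in at_top. \<forall>n\<le>N. E r g f n = (\<Sum>j\<in>{-B..B}. r (g j) (P j f n))"
proof -
  obtain L where L: "\<forall>n<L. g n = 0" using assms by blast
  obtain K where K: "\<And>j n. j \<ge> K \<Longrightarrow> n \<le> N \<Longrightarrow> P j f n = 0"
    using P_vanish_ex[OF assms(2)] by blast
  have "E r g f n = (\<Sum>j\<in>{-B..B}. r (g j) (P j f n))" if "B \<ge> max (-L) K" "n \<le> N" for B n
    by (intro E_eq) (use L K that in \<open>force simp: not_le\<close>)+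
  then show ?thesis unfolding eventually_at_top_linorder by blast
qed

lemma E_lower:
  assumes "\<exists>L. \<forall>n<L. g n = 0" "\<exists>L. \<forall>n<L. f n = 0"
  shows "\<exists>L. \<forall>n<L. E r g f n = 0"
proof -
  obtain L where L: "\<forall>n<L. g n = 0" using assms by blast
  obtain K where K: "\<And>j n. j \<ge> L \<Longrightarrow> n < K \<Longrightarrow> P j f n = 0"
    using P_lower_ex[OF assms(2)] by blast
  have "E r g f n = 0" if "n < K" for n
  proof -
    have "g j = 0 \<or> P j f n = 0" for j
      using L K that by (cases "j < L") auto
    then have "{j. g j \<noteq> 0 \<and> P j f n \<noteq> 0} = {}" by blast
    then show ?thesis by (simp only: E_def sum.empty)
  qed
  then show ?thesis by blast
qed

lemma bb_add:
  assumes "\<exists>L::int. \<forall>n<L. g n = (0::'b::comm_monoid_add)" "\<exists>L. \<forall>n<L. g' n = 0"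
  shows "\<exists>L. \<forall>n<L. g n + g' n = 0"
proof -
  obtain L L' where "\<forall>n<L. g n = 0" "\<forall>n<L'. g' n = 0" using assms by blast
  then show ?thesis by (intro exI[of _ "min L L'"]) auto
qed

lemma E_add_left:
  assumes "\<exists>L. \<forall>n<L. g n = 0" "\<exists>L. \<forall>n<L. g' n = 0" "\<exists>L. \<forall>n<L. f n = 0"
  shows "E r (\<lambda>n. g n + g' n) f n = E r g f n + E r g' f n"
proof -
  have "\<forall>\<^sub>F B::int in at_top. E r (\<lambda>n. g n + g' n) f n = E r g f n + E r g' f n"
    using E_range[OF assms(1,3), of n] E_range[OF assms(2,3), of n]
      E_range[OF bb_add[OF assms(1,2)] assms(3), of n]
    by eventually_elim (simp add: r_add_left sum.distrib)
  then show ?thesis by (simp add: eventually_const_iff)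
qed

lemma E_add_right:
  assumes "\<exists>L. \<forall>n<L. g n = 0" "\<exists>L. \<forall>n<L. f n = 0" "\<exists>L. \<forall>n<L. f' n = 0"
  shows "E r g (\<lambda>n. f n + f' n) n = E r g f n + E r g f' n"
proof -
  have "\<forall>\<^sub>F B::int in at_top. E r g (\<lambda>n. f n + f' n) n = E r g f n + E r g f' n"
    using E_range[OF assms(1,2), of n] E_range[OF assms(1,3), of n]
      E_range[OF assms(1) bb_add[OF assms(2,3)], of n]
    by eventually_elim (simp add: r_add_right sum.distrib P_add)
  then show ?thesis by (simp add: eventually_const_iff)
qed

lemma E_e_right: "E r g (e l) n = g (n - l)"
  by (subst E_eq[of "{n - l}"]) (auto simp: P_e r_1)

lemma E_shift_right: "E r g (\<lambda>n. f (n + l)) n = E r g f (n + l)"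
  by (simp add: E_def P_shift)

end

lemma right_module_mult: "right_module (*) 1 ((*) :: 'a \<Rightarrow> 'a \<Rightarrow> 'a)"
  by (simp add: right_module_def algebra_simps)

lemmas E_mult_eq = E_eq[OF right_module_mult]
lemmas E_mult_range = E_range[OF right_module_mult]
lemmas E_mult_lower = E_lower[OF right_module_mult]

lemma T_lower: "\<exists>L. \<forall>n<L. f n = 0 \<Longrightarrow> \<exists>L. \<forall>n<L. T f n = 0"
proof -
  assume "\<exists>L. \<forall>n<L. f n = 0"
  then obtain L where "\<forall>n<L. f n = 0" by blast
  then have "\<forall>n<L. T f n = 0" by (simp add: T_def)
  then show ?thesis ..
qed

lemma P_lower': "\<exists>L. \<forall>n<L. f n = 0 \<Longrightarrow> \<exists>L. \<forall>n<L. P j f n = 0"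
  using P_lower_ex[of f j] by (metis order_refl)

lemma T_E:
  assumes "\<exists>L. \<forall>n<L. g n = 0" "\<exists>L. \<forall>n<L. f n = 0"
  shows "T (E (*) g f) = E (*) (T g) f"
proof
  fix n
  have 1: "T (E (*) g f) n = (\<Sum>j\<in>{-B..B+1}. T g j * P j f n)"
    if B: "\<forall>n'\<le>n. E (*) g f n' = (\<Sum>j\<in>{-B..B}. g j * P j f n')"
      "g (- B - 1) = 0" "P (B + 1) f n = 0" "B \<ge> 1" for B
  proof -
    let ?J = "{-B..B}"
    have "T (E (*) g f) n = (\<Sum>j\<in>?J. \<sigma> (g j * P j f (n - 1)) + \<delta> (g j * P j f n))"
      using B(1) by (simp add: T_def s.sum d.sum sum.distrib)
    also have "\<dots> = (\<Sum>j\<in>?J. \<sigma> (g j) * P (j + 1) f n + \<delta> (g j) * P j f n)"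
      by (intro sum.cong) (simp_all add: sigma_mult delta_mult P_Suc T_def algebra_simps)
    also have "\<dots> = (\<Sum>j\<in>?J. \<sigma> (g j) * P (j + 1) f n) + (\<Sum>j\<in>?J. \<delta> (g j) * P j f n)"
      by (rule sum.distrib)
    also have "(\<Sum>j\<in>?J. \<sigma> (g j) * P (j + 1) f n) = (\<Sum>j\<in>{-B+1..B+1}. \<sigma> (g (j - 1)) * P j f n)"
      by (rule sum.reindex_bij_witness[of _ "\<lambda>j. j - 1" "\<lambda>j. j + 1"]) auto
    also have "\<dots> = (\<Sum>j\<in>{-B..B+1}. \<sigma> (g (j - 1)) * P j f n)"
    proof (rule sum.mono_neutral_left)
      have "g (i - 1) = 0" if "i \<in> {-B..B+1} - {-B+1..B+1}" for i
      proof -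
        have "i - 1 = - B - 1" using that by auto
        then show ?thesis using B(2) by (simp only:)
      qed
      then show "\<forall>i\<in>{-B..B+1} - {-B+1..B+1}. \<sigma> (g (i - 1)) * P i f n = 0"
        by (intro ballI) (simp only: s.zero mult_zero_left)
    qed auto
    also have "(\<Sum>j\<in>?J. \<delta> (g j) * P j f n) = (\<Sum>j\<in>{-B..B+1}. \<delta> (g j) * P j f n)"
      by (rule sum.mono_neutral_left) (use B in \<open>auto simp: not_le order_le_less\<close>)
    finally show ?thesis by (simp add: T_def sum.distrib distrib_right)
  qed
  obtain L where L: "\<forall>n<L. g n = 0" using assms by blast
  obtain K where K: "\<And>j n'. j \<ge> K \<Longrightarrow> n' \<le> n \<Longrightarrow> P j f n' = 0"
    using P_vanish_ex[OF assms(2)] by blast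
  have "\<forall>\<^sub>F B::int in at_top. T (E (*) g f) n = E (*) (T g) f n"
    using E_mult_range[OF assms, of n] eventually_ge_at_top[of "\<bar>L\<bar>"] eventually_ge_at_top[of "\<bar>K\<bar>"]
      eventually_ge_at_top[of 1]
  proof eventually_elim
    case (elim B)
    have "T (E (*) g f) n = (\<Sum>j\<in>{-B..B+1}. T g j * P j f n)"
      using elim L K by (intro 1) auto
    also have "\<dots> = E (*) (T g) f n"
      using elim L K by (intro E_mult_eq[symmetric]) (auto simp: not_le T_def)
    finally show ?case .
  qed
  then show "T (E (*) g f) n = E (*) (T g) f n" by (simp add: eventually_const_iff)
qed

lemma U_lower: "\<exists>L. \<forall>n<L. f n = 0 \<Longrightarrow> \<exists>L. \<forall>n<L. U f n = 0"
  using P_lower'[of f "-1"] by (simp add: P_def)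

lemma U_E:
  assumes "\<exists>L. \<forall>n<L. g n = 0" "\<exists>L. \<forall>n<L. f n = 0"
  shows "U (E (*) g f) = E (*) (U g) f"
  using T_E[OF U_lower[OF assms(1)] assms(2)] by (metis T_U U_T)

lemma P_E:
  assumes "\<exists>L. \<forall>n<L. g n = 0" "\<exists>L. \<forall>n<L. f n = 0"
  shows "P j (E (*) g f) = E (*) (P j g) f"
proof (induction j rule: int_induct[where k = 0])
  case (step1 j) then show ?case by (simp add: P_Suc T_E P_lower' assms)
next
  case (step2 j) then show ?case by (simp add: P_pred U_E P_lower' assms)
qed simp

lemma E_assoc:
  assumes r: "right_module (*) 1 r"
    and "\<exists>L. \<forall>n<L. g n = 0" "\<exists>L. \<forall>n<L. f n = 0" "\<exists>L. \<forall>n<L. h n = 0"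
  shows "E r (E r g f) h n = E r g (E (*) f h) n"
proof -
  obtain L where L: "\<forall>n<L. g n = 0" using assms by blast
  obtain M where M: "\<And>j n'. j \<ge> L \<Longrightarrow> n' < M \<Longrightarrow> P j f n' = 0"
    using P_lower_ex[OF assms(3)] by blast
  obtain K where K: "\<And>j n'. j \<ge> K \<Longrightarrow> n' \<le> n \<Longrightarrow> P j h n' = 0"
    using P_vanish_ex[OF assms(4)] by blast
  obtain K2 where K2: "\<And>j n'. j \<ge> K2 \<Longrightarrow> n' \<le> K \<Longrightarrow> P j f n' = 0"
    using P_vanish_ex[OF assms(3)] by blast
  obtain K3 where K3: "\<And>j n'. j \<ge> K3 \<Longrightarrow> n' \<le> n \<Longrightarrow> P j (E (*) f h) n' = 0"
    using P_vanish_ex[OF E_mult_lower[OF assms(3,4)]] by blast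
  let ?I = "{M..K}" and ?J = "{L..max K2 K3}"
  have gf: "E r g f i = (\<Sum>j\<in>?J. r (g j) (P j f i))" if "i \<le> K" for i
    using L K2 that by (intro E_eq[OF r]) (force simp: not_le)+
  have "E r g f i = 0 \<or> P i h n = 0" if "i \<notin> ?I" for i
  proof (cases "i < M")
    case True
    then have "g j = 0 \<or> P j f i = 0" for j
      using L M by (cases "j < L") auto
    then have "{j. g j \<noteq> 0 \<and> P j f i \<noteq> 0} = {}" by blast
    then show ?thesis by (simp only: E_def sum.empty simp_thms)
  next
    case False then show ?thesis using K that by auto
  qed
  then have "E r (E r g f) h n = (\<Sum>i\<in>?I. r (E r g f i) (P i h n))"
    by (intro E_eq[OF r]) auto
  also have "\<dots> = (\<Sum>i\<in>?I. \<Sum>j\<in>?J. r (g j) (P j f i * P i h n))"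
    by (intro sum.cong) (simp_all add: gf r_sum_left[OF r] r_mult[OF r])
  also have "\<dots> = (\<Sum>j\<in>?J. \<Sum>i\<in>?I. r (g j) (P j f i * P i h n))"
    by (rule sum.swap)
  also have "\<dots> = (\<Sum>j\<in>?J. r (g j) (E (*) (P j f) h n))"
    by (intro sum.cong refl, subst E_mult_eq[of ?I])
      (use M K in \<open>force simp: r_sum_right[OF r] not_le\<close>)+
  also have "\<dots> = (\<Sum>j\<in>?J. r (g j) (P j (E (*) f h) n))"
    by (simp add: P_E assms)
  also have "\<dots> = E r g (E (*) f h) n"
    using L K3 by (intro E_eq[OF r, symmetric]) (force simp: not_le)+
  finally show ?thesis .
qed

lemma fls_bb: "\<exists>L. \<forall>n<L. g $$ n = 0"
  by (meson fls_nth_vanishes_belowE)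

definition lact :: "('m::ab_group_add \<Rightarrow> 'a \<Rightarrow> 'm) \<Rightarrow> 'm fls \<Rightarrow> 'a fls \<Rightarrow> 'm fls" where
  "lact r g f = Abs_fls (E r (fls_nth g) (fls_nth f))"

lemma lact_nth: "right_module (*) 1 r \<Longrightarrow> lact r g f $$ n = E r (fls_nth g) (fls_nth f) n"
  unfolding lact_def by (intro nth_Abs_fls_ex_lower_bound E_lower fls_bb)

lemmas lmul_nth = lact_nth[OF right_module_mult]

lemma lmul_nth': "fls_nth (lact (*) g f) = E (*) (fls_nth g) (fls_nth f)"
  by (rule ext) (rule lmul_nth)

lemma fls_one_nth': "fls_nth 1 = e 0"
  by (auto simp: fun_eq_iff)

lemma lact_assoc:
  assumes "right_module (*) 1 r"
  shows "lact r (lact r g f) h = lact r g (lact (*) f h)"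
proof (rule fls_eqI)
  fix n
  have "fls_nth (lact r g f) = E r (fls_nth g) (fls_nth f)"
    by (rule ext) (rule lact_nth[OF assms])
  then show "lact r (lact r g f) h $$ n = lact r g (lact (*) f h) $$ n"
    by (simp add: lact_nth[OF assms] lmul_nth' E_assoc[OF assms] fls_bb)
qed

lemma lact_add_left: "right_module (*) 1 r \<Longrightarrow> lact r (g + g') f = lact r g f + lact r g' f"
proof (rule fls_eqI)
  fix n assume r: "right_module (*) 1 r"
  have "fls_nth (g + g') = (\<lambda>n. g $$ n + g' $$ n)" by (rule ext) simp
  then show "lact r (g + g') f $$ n = (lact r g f + lact r g' f) $$ n"
    by (simp add: lact_nth[OF r] E_add_left[OF r] fls_bb)
qed

lemma lact_add_right: "right_module (*) 1 r \<Longrightarrow> lact r g (f + f') = lact r g f + lact r g f'"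
proof (rule fls_eqI)
  fix n assume r: "right_module (*) 1 r"
  have "fls_nth (f + f') = (\<lambda>n. f $$ n + f' $$ n)" by (rule ext) simp
  then show "lact r g (f + f') $$ n = (lact r g f + lact r g f') $$ n"
    by (simp add: lact_nth[OF r] E_add_right[OF r] fls_bb)
qed

lemma lact_one: "right_module (*) 1 r \<Longrightarrow> lact r g 1 = g"
  by (rule fls_eqI) (simp add: lact_nth fls_one_nth' E_e_right)

lemma lmul_e: "(\<And>n. g $$ n = e l n) \<Longrightarrow> lact (*) g f $$ n = P l (fls_nth f) n"
  unfolding lmul_nth by (subst E_mult_eq[of "{l}"]) auto

lemma fls_of_poly_nth: "fls_of_poly p $$ n = (if n < 0 then 0 else coeff p (nat n))"
  by (simp add: fls_of_poly_def)

lemma coeff_skew_poly_X: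
  "coeff (skew_poly_X \<sigma> \<delta> p) k = (case k of 0 \<Rightarrow> 0 | Suc i \<Rightarrow> \<sigma> (coeff p i)) + \<delta> (coeff p k)"
  by (simp add: skew_poly_X_def coeff_pCons coeff_map_poly split: nat.split)

lemma T_poly: "T (fls_nth (fls_of_poly p)) = fls_nth (fls_of_poly (skew_poly_X \<sigma> \<delta> p))"
proof
  fix n :: int
  show "T (fls_nth (fls_of_poly p)) n = fls_of_poly (skew_poly_X \<sigma> \<delta> p) $$ n"
  proof (cases "n \<le> 0")
    case True then show ?thesis
      by (cases "n = 0") (simp_all add: T_def fls_of_poly_nth coeff_skew_poly_X)
  next
    case False
    then have "nat n = Suc (nat (n - 1))" by simp
    then show ?thesis using False by (simp add: T_def fls_of_poly_nth coeff_skew_poly_X)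
  qed
qed

lemma P_poly: "P (int i) (fls_nth (fls_of_poly p)) = fls_nth (fls_of_poly ((skew_poly_X \<sigma> \<delta> ^^ i) p))"
proof (induction i)
  case (Suc i)
  have "int (Suc i) = int i + 1" by simp
  then show ?case using Suc by (simp only: P_Suc T_poly funpow.simps o_apply)
qed simp

lemma coeff_skew_poly_mult:
  "coeff (skew_poly_mult \<sigma> \<delta> p q) k = (\<Sum>i\<le>degree p. coeff p i * coeff ((skew_poly_X \<sigma> \<delta> ^^ i) q) k)"
  by (simp add: skew_poly_mult_def coeff_sum coeff_map_poly)

lemma lmul_poly: "lact (*) (fls_of_poly p) (fls_of_poly q) = fls_of_poly (skew_poly_mult \<sigma> \<delta> p q)"
proof (rule fls_eqI)
  fix n
  have "lact (*) (fls_of_poly p) (fls_of_poly q) $$ n =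
      (\<Sum>j\<in>int ` {..degree p}. fls_of_poly p $$ j * P j (fls_nth (fls_of_poly q)) n)"
    unfolding lmul_nth
  proof (rule E_mult_eq)
    fix j assume "j \<notin> int ` {..degree p}"
    then have "j < 0 \<or> nat j > degree p"
      by (metis atMost_iff image_eqI int_nat_eq not_le)
    then show "fls_of_poly p $$ j = 0 \<or> P j (fls_nth (fls_of_poly q)) n = 0"
      by (auto simp: fls_of_poly_nth coeff_eq_0)
  qed simp
  also have "\<dots> = (\<Sum>i\<le>degree p. coeff p i * fls_of_poly ((skew_poly_X \<sigma> \<delta> ^^ i) q) $$ n)"
    by (subst sum.reindex) (simp_all add: P_poly fls_of_poly_nth)
  also have "\<dots> = fls_of_poly (skew_poly_mult \<sigma> \<delta> p q) $$ n"
    by (simp add: fls_of_poly_nth coeff_skew_poly_mult)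
  finally show "lact (*) (fls_of_poly p) (fls_of_poly q) $$ n =
    fls_of_poly (skew_poly_mult \<sigma> \<delta> p q) $$ n" .
qed

lemma coeff_fps_trunc: "coeff (fps_trunc q s) i = (if i \<le> q then fps_nth s i else 0)"
  by (simp add: fps_trunc_def coeff_sum if_distrib cong: if_cong)

lemma T_local: "(\<And>k. k \<le> n \<Longrightarrow> f k = g k) \<Longrightarrow> (T ^^ j) f n = (T ^^ j) g n"
proof (induction j arbitrary: n)
  case (Suc j)
  then have "(T ^^ j) f n = (T ^^ j) g n" "(T ^^ j) f (n - 1) = (T ^^ j) g (n - 1)" by simp_all
  moreover have "T h n = \<sigma> (h (n - 1)) + \<delta> (h n)" for h by (rule T_def)
  ultimately show ?case by simp
qed simp

lemma P_local: "j \<ge> 0 \<Longrightarrow> (\<And>k. k \<le> n \<Longrightarrow> f k = g k) \<Longrightarrow> P j f n = P j g n"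
  unfolding P_def by (auto intro: T_local)

lemma P_const:
  "P (int j) (fls_nth (fls_of_poly [:a:])) (int i) = coeff (skew_poly_mult \<sigma> \<delta> (monom 1 j) [:a:]) i"
proof -
  have "lact (*) (fls_of_poly (monom 1 j)) (fls_of_poly [:a:]) $$ int i =
    P (int j) (fls_nth (fls_of_poly [:a:])) (int i)"
    by (rule lmul_e) (auto simp: fls_of_poly_nth)
  then show ?thesis by (simp add: lmul_poly fls_of_poly_nth)
qed

lemma P_trunc_vanish:
  assumes "\<And>i. i \<le> n \<Longrightarrow> skew_bound \<sigma> \<delta> n (fps_nth t i) q" "j \<ge> int q"
  shows "P j (fls_nth (fps_to_fls t)) (int n) = 0"
proof -
  have "P j (fls_nth (fps_to_fls t)) (int n) =
      P j (\<lambda>k. \<Sum>i\<le>n. fls_nth (fls_of_poly [:fps_nth t i:]) (k + - int i)) (int n)"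
  proof (rule P_local)
    fix k assume k: "k \<le> int n"
    have "fls_of_poly [:fps_nth t i:] $$ (k + - int i) = (if int i = k then fps_nth t i else 0)" for i
      by (auto simp: fls_of_poly_nth coeff_pCons split: nat.split)
    then have "(\<Sum>i\<le>n. fls_of_poly [:fps_nth t i:] $$ (k + - int i)) =
        (\<Sum>i\<le>n. if i = nat k \<and> k \<ge> 0 then fps_nth t i else 0)"
      by (intro sum.cong) auto
    then show "fps_to_fls t $$ k = (\<Sum>i\<le>n. fls_of_poly [:fps_nth t i:] $$ (k + - int i))"
      using k by (cases "k \<ge> 0") auto
  qed (use assms in simp)
  also have "\<dots> = (\<Sum>i\<le>n. P j (fls_nth (fls_of_poly [:fps_nth t i:])) (int n + - int i))"
    by (simp only: P_sum P_shift finite_atMost)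
  also have "\<dots> = (\<Sum>i\<le>n. P (int (nat j)) (fls_nth (fls_of_poly [:fps_nth t i:])) (int (n - i)))"
    using assms(2) by (intro sum.cong) (simp_all add: of_nat_diff)
  also have "\<dots> = 0"
    using assms unfolding P_const skew_bound_def by (intro sum.neutral) (auto simp: le_nat_iff)
  finally show ?thesis .
qed

lemma lmul_fps:
  assumes "\<And>n i. i \<le> n \<Longrightarrow> skew_bound \<sigma> \<delta> n (fps_nth t i) (q n)"
  shows "lact (*) (fps_to_fls s) (fps_to_fls t) =
    fps_to_fls (Abs_fps (\<lambda>n. coeff (skew_poly_mult \<sigma> \<delta> (fps_trunc (q n) s) (fps_trunc n t)) n))"
proof (rule fls_eqI)
  fix k
  let ?t = "fls_nth (fps_to_fls t)"
  show "lact (*) (fps_to_fls s) (fps_to_fls t) $$ k = fps_to_fls (Abs_fps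
      (\<lambda>n. coeff (skew_poly_mult \<sigma> \<delta> (fps_trunc (q n) s) (fps_trunc n t)) n)) $$ k" (is "?L = ?R")
  proof (cases "k < 0")
    case True
    have "fps_to_fls s $$ j = 0 \<or> P j ?t k = 0" for j
      using P_lower[of 0 ?t k j] True by auto
    then show ?thesis using True by (simp add: lmul_nth E_mult_eq[of "{}"])
  next
    case False
    define n where "n = nat k"
    have k: "k = int n" using False by (simp add: n_def)
    have "?L = (\<Sum>j\<in>{0..int (q n)}. fps_to_fls s $$ j * P j ?t k)"
      unfolding lmul_nth
    proof (rule E_mult_eq)
      fix j assume "j \<notin> {0..int (q n)}"
      then show "fps_to_fls s $$ j = 0 \<or> P j ?t k = 0"
        unfolding k using P_trunc_vanish[of n t "q n" j] assms by auto
    qed simp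
    also have "\<dots> = (\<Sum>j\<in>{0..int (q n)}. fls_of_poly (fps_trunc (q n) s) $$ j *
        P j (fls_nth (fls_of_poly (fps_trunc n t))) k)"
      by (intro sum.cong arg_cong2[of _ _ _ _ "(*)"] P_local)
        (auto simp: fls_of_poly_nth coeff_fps_trunc k nat_le_iff)
    also have "\<dots> = lact (*) (fls_of_poly (fps_trunc (q n) s)) (fls_of_poly (fps_trunc n t)) $$ k"
      unfolding lmul_nth
      by (rule E_mult_eq[symmetric]) (auto simp: fls_of_poly_nth coeff_fps_trunc nat_le_iff)
    also have "\<dots> = ?R"
      by (simp add: lmul_poly fls_of_poly_nth k)
    finally show ?thesis .
  qed
qed

lemma skew_bound_ex: "\<exists>q. \<forall>n. \<forall>i\<le>n. skew_bound \<sigma> \<delta> n (fps_nth t i) (q n)"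
proof -
  have "skew_bound \<sigma> \<delta> n a (Suc n * m)" for n a
    unfolding skew_bound_def
  proof (intro allI impI)
    fix i j assume ij: "i \<le> n" "Suc n * m \<le> j"
    have "(T ^^ j) (fls_nth (fls_of_poly [:a:])) (int i) = 0"
      using ij by (intro T_vanish[of 0 _ _ "Suc n"]) (auto simp: fls_of_poly_nth)
    then show "coeff (skew_poly_mult \<sigma> \<delta> (monom 1 j) [:a:]) i = 0"
      using P_const[of j a i] by (simp add: P_def)
  qed
  then show ?thesis by (intro exI[of _ "\<lambda>n. Suc n * m"]) blast
qed

lemma U_any:
  assumes "\<delta>' ^^ m' = (\<lambda>_. 0)"
  shows "U f n = (\<Sum>k=0..m'. \<sigma>' ((\<delta>' ^^ k) (f (n + 1 + int k))))"
proof -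
  have z: "(\<delta>' ^^ k) a = 0" if "k \<ge> m \<or> k \<ge> m'" for k a
  proof -
    have "(\<delta>' ^^ (k - l + l)) a = 0" if "\<delta>' ^^ l = (\<lambda>_. 0)" for l
      using that by (simp only: funpow_add o_apply d'_pow_0)
    from this[OF nil'] this[OF assms] that show ?thesis by auto
  qed
  have "U f n = (\<Sum>k\<in>{..max m m'}. \<sigma>' ((\<delta>' ^^ k) (f (n + 1 + int k))))"
    unfolding U_def by (rule sum.mono_neutral_left) (auto simp: z)
  also have "\<dots> = (\<Sum>k=0..m'. \<sigma>' ((\<delta>' ^^ k) (f (n + 1 + int k))))"
    by (rule sum.mono_neutral_right) (auto simp: z)
  finally show ?thesis .
qed

lemma lmul_X_inv:
  assumes "\<delta>' ^^ m' = (\<lambda>_. 0)"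
  shows "lact (*) fls_X_inv (fps_to_fls s) =
    (\<Sum>k=0..m'. fls_shift (1 + int k) (fps_to_fls (fps_map (\<lambda>a. \<sigma>' ((\<delta>' ^^ k) a)) s)))"
proof (rule fls_eqI)
  fix n
  have "lact (*) fls_X_inv (fps_to_fls s) $$ n = P (-1) (fls_nth (fps_to_fls s)) n"
    by (rule lmul_e) simp
  also have "\<dots> = U (fls_nth (fps_to_fls s)) n" by (simp add: P_def)
  finally show "lact (*) fls_X_inv (fps_to_fls s) $$ n =
    (\<Sum>k=0..m'. fls_shift (1 + int k) (fps_to_fls (fps_map (\<lambda>a. \<sigma>' ((\<delta>' ^^ k) a)) s))) $$ n"
    by (auto simp: U_any[OF assms] fls_nth_sum fps_map_def algebra_simps intro!: sum.cong)
qed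

lemma is_skew_laurent_mult_lact: "is_skew_laurent_mult \<sigma> \<delta> (lact (*))"
proof -
  note r = right_module_mult
  have "lact (*) 1 t = t" for t :: "'a fls"
    by (rule fls_eqI) (subst lmul_e[of _ 0], auto)
  moreover have "lact (*) (fps_to_fls s) (fls_X_intpow l) = fls_shift (- l) (fps_to_fls s)" for s l
  proof (rule fls_eqI)
    fix n
    have "fls_nth (fls_X_intpow l) = e l" by (auto simp: fun_eq_iff)
    then show "lact (*) (fps_to_fls s) (fls_X_intpow l) $$ n = fls_shift (- l) (fps_to_fls s) $$ n"
      by (simp add: lmul_nth E_e_right[OF r])
  qed
  ultimately show ?thesis
    unfolding is_skew_laurent_mult_def
    by (intro conjI allI impI)
      (simp_all add: lact_assoc[OF r] lact_add_left[OF r] lact_add_right[OF r] lact_one[OF r]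
        lmul_poly lmul_fps lmul_X_inv)
qed

lemma fls_decomp:
  fixes s :: "'a fls"
  obtains k s0 where "s = fls_shift (int k) (fps_to_fls s0)"
proof -
  obtain K where K: "\<forall>n<K. s $$ n = 0" using fls_bb by blast
  show ?thesis
  proof (rule that, rule fls_eqI)
    fix n show "s $$ n = fls_shift (int (nat (- K)))
        (fps_to_fls (Abs_fps (\<lambda>i. s $$ (int i - int (nat (- K)))))) $$ n"
      using K by auto
  qed
qed

lemma fls_X_intpow_fps: "c \<ge> 0 \<Longrightarrow>
  (fls_X_intpow c :: 'a fls) = fps_to_fls (Abs_fps (\<lambda>i. if i = nat c then 1 else 0))"
  by (rule fls_eqI) auto

context
  fixes mul assumes mul: "is_skew_laurent_mult \<sigma> \<delta> mul"
begin

lemma mul_assoc: "mul (mul s t) u = mul s (mul t u)"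
  and mul_one: "mul 1 s = s" "mul s 1 = s"
  and mul_X: "mul (fps_to_fls v) (fls_X_intpow l) = fls_shift (- l) (fps_to_fls v)"
  using mul by (simp_all add: is_skew_laurent_mult_def)

lemma mul_fps: "mul (fps_to_fls s) (fps_to_fls t) = lact (*) (fps_to_fls s) (fps_to_fls t)"
proof -
  obtain q where q: "\<forall>n. \<forall>i\<le>n. skew_bound \<sigma> \<delta> n (fps_nth t i) (q n)" using skew_bound_ex by blast
  with mul show ?thesis by (subst lmul_fps[of t q]) (auto simp: is_skew_laurent_mult_def)
qed

lemma mul_X_inv: "mul fls_X_inv (fps_to_fls s) = lact (*) fls_X_inv (fps_to_fls s)"
proof -
  have nils: "Suc m \<ge> 1 \<and> \<delta> ^^ Suc m = (\<lambda>_. 0) \<and> \<delta>' ^^ Suc m = (\<lambda>_. 0)"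
    by (simp add: nil nil' fun_eq_iff)
  note * = mul[unfolded is_skew_laurent_mult_def, THEN conjunct2, THEN conjunct2, THEN conjunct2,
      THEN conjunct2, THEN conjunct2, THEN conjunct2, THEN conjunct2, rule_format, OF nils, of s]
  show ?thesis using lmul_X_inv[of "Suc m" s] nils unfolding * by (simp only:)
qed

lemma mul_X_inv_X: "mul fls_X_inv (fls_X_intpow l) = fls_X_intpow (l - 1)"
proof -
  have "fls_nth (fls_X_intpow 1) = e 1" by (auto simp: fun_eq_iff)
  then have "lact (*) fls_X_inv (fls_X_intpow 1) = 1"
    by (intro fls_eqI) (subst lmul_e[of _ "-1"], auto simp: P_e)
  then have "mul fls_X_inv (fls_X_intpow 1) = 1"
    using fls_X_intpow_fps[of 1] mul_X_inv by simp
  moreover have "mul (fls_X_intpow 1) (fls_X_intpow (l - 1)) = fls_shift (- (l - 1)) (fls_X_intpow 1)"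
    using fls_X_intpow_fps[of 1] mul_X[of _ "l - 1"] by simp
  then have "mul (fls_X_intpow 1) (fls_X_intpow (l - 1)) = fls_X_intpow l" by simp
  ultimately show ?thesis by (metis mul_assoc mul_one(1))
qed

lemma mul_X_X: "mul (fls_X_intpow c) (fls_X_intpow l) = fls_X_intpow (c + l)"
proof (induction c rule: int_induct[where k = 0])
  case base then show ?case by (simp add: mul_one)
next
  case (step1 c)
  then have "mul (fls_X_intpow (c + 1)) (fls_X_intpow l) = fls_shift (- l) (fls_X_intpow (c + 1))"
    using fls_X_intpow_fps[of "c + 1"] mul_X[of _ l] step1(1) by simp
  then show ?case by (simp add: algebra_simps)
next
  case (step2 c)
  have "mul (fls_X_intpow (c - 1)) (fls_X_intpow l) = mul fls_X_inv (fls_X_intpow (c + l))"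
    by (metis mul_X_inv_X mul_assoc step2(2))
  moreover have "c - 1 + l = c + l - 1" by simp
  ultimately show ?case by (simp only: mul_X_inv_X)
qed

lemma mul_X': "mul s (fls_X_intpow l) = fls_shift (- l) s"
proof -
  obtain k s0 where s: "s = fls_shift (int k) (fps_to_fls s0)" by (rule fls_decomp[of s])
  then have "s = mul (fps_to_fls s0) (fls_X_intpow (- int k))" 
    using mul_X[of s0 "- int k"] by (simp only: minus_minus)
  then have "mul s (fls_X_intpow l) = mul (fps_to_fls s0) (fls_X_intpow (- int k + l))"
    by (simp only: mul_assoc mul_X_X)
  then show ?thesis using mul_X[of s0 "- int k + l"] s by simp
qed

lemma mul_shift: "mul s (fls_shift l t) = fls_shift l (mul s t)"
  using mul_X'[of t "- l"] mul_X'[of "mul s t" "- l"] mul_assoc[of s t "fls_X_intpow (- l)"]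
  by (simp only: minus_minus)

end

lemma mul_eq_lact:
  assumes mul: "is_skew_laurent_mult \<sigma> \<delta> mul"
  shows "mul = lact (*)"
proof (intro ext)
  fix s t :: "'a fls"
  note l = is_skew_laurent_mult_lact
  have inv: "mul fls_X_inv t = lact (*) fls_X_inv t" for t
    by (rule fls_decomp[of t]) (simp only: mul_shift[OF mul] mul_shift[OF l] mul_X_inv[OF mul])
  have pow: "mul (fls_X_intpow (- int k)) t = lact (*) (fls_X_intpow (- int k)) t" for k t
  proof (induction k)
    case 0 then show ?case using mul_one[OF mul] mul_one[OF l] by simp
  next
    case (Suc k)
    have "- int k - 1 = - int (Suc k)" by simp
    then show ?case
      using mul_X_inv_X[OF mul, of "- int k"] mul_X_inv_X[OF l, of "- int k"]
        mul_assoc[OF mul, of fls_X_inv "fls_X_intpow (- int k)" t]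
        mul_assoc[OF l, of fls_X_inv "fls_X_intpow (- int k)" t] Suc inv by (simp only:)
  qed
  have fps: "mul (fps_to_fls v) t = lact (*) (fps_to_fls v) t" for v t
    by (rule fls_decomp[of t]) (simp only: mul_shift[OF mul] mul_shift[OF l] mul_fps[OF mul])
  obtain k s0 where s: "s = fls_shift (int k) (fps_to_fls s0)" by (rule fls_decomp[of s])
  have "s = mul (fps_to_fls s0) (fls_X_intpow (- int k))"
    "s = lact (*) (fps_to_fls s0) (fls_X_intpow (- int k))"
    using s mul_X[OF mul, of s0 "- int k"] mul_X[OF l, of s0 "- int k"] by (simp_all only: minus_minus)
  then show "mul s t = lact (*) s t"
    by (metis mul_assoc[OF mul] mul_assoc[OF l] pow fps)
qed

lemma skew_laurent_mult_eq: "skew_laurent_mult \<sigma> \<delta> = lact (*)"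
  unfolding skew_laurent_mult_def
  by (rule the_equality) (auto intro: is_skew_laurent_mult_lact mul_eq_lact)

lemma fls_tensor_nth:
  fixes r :: "'m::ab_group_add \<Rightarrow> 'a \<Rightarrow> 'm" and s :: "'a fls"
  assumes "right_module (*) 1 r"
  shows "fls_tensor r y s $$ n = r y (s $$ n)"
  unfolding fls_tensor_def
proof (rule nth_Abs_fls_ex_lower_bound)
  obtain L where "\<forall>n<L. s $$ n = 0" using fls_bb by blast
  then show "\<exists>L. \<forall>n<L. r y (s $$ n) = 0" using r_0_right[OF assms, of y] by force
qed

lemma is_laurent_act_lact:
  fixes r :: "'m::ab_group_add \<Rightarrow> 'a \<Rightarrow> 'm"
  assumes r: "right_module (*) 1 r"
  shows "is_laurent_act \<sigma> \<delta> r (lact r)"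
proof -
  have "lact r (fls_tensor r y s) t = fls_tensor r y (lact (*) s t)" for y s t
  proof (rule fls_eqI)
    fix n
    have "fls_nth (fls_tensor r y s) = (\<lambda>n. r y (s $$ n))"
      by (rule ext) (rule fls_tensor_nth[OF r])
    then have nth: "E r (\<lambda>n. r y (s $$ n)) f = E r (fls_nth (fls_tensor r y s)) f" for f
      by (simp only:)
    have "\<forall>\<^sub>F B::int in at_top.
        lact r (fls_tensor r y s) t $$ n = fls_tensor r y (lact (*) s t) $$ n"
      using E_range[OF r fls_bb fls_bb, of n "fls_tensor r y s" t]
        E_mult_range[OF fls_bb fls_bb, of n s t]
      by eventually_elim
        (simp add: lact_nth[OF r] lmul_nth fls_tensor_nth[OF r] r_sum_right[OF r] r_mult[OF r] nth)
    then show "lact r (fls_tensor r y s) t $$ n = fls_tensor r y (lact (*) s t) $$ n"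
      by (simp add: eventually_const_iff)
  qed
  then show ?thesis
    unfolding is_laurent_act_def right_module_def skew_laurent_mult_eq
    by (simp add: lact_assoc[OF r] lact_add_left[OF r] lact_add_right[OF r] lact_one[OF r])
qed

end

lemma skew_data_ex:
  assumes "left_skew_derivation \<sigma> \<delta>" "bij \<sigma>"
    and "nilpotent_map \<delta>" "nilpotent_map (twisted_derivation \<sigma> \<delta>)"
  shows "\<exists>m. skew_data \<sigma> \<delta> m"
proof -
  obtain k l where kl: "\<delta> ^^ k = (\<lambda>_. 0)" "twisted_derivation \<sigma> \<delta> ^^ l = (\<lambda>_. 0)"
    using assms(3,4) by (auto simp: nilpotent_map_def)
  have "f ^^ (a + b) = (\<lambda>_. 0)" if "f ^^ a = (\<lambda>_. 0) \<or> f ^^ b = (\<lambda>_. 0)" "f 0 = 0"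
    for a b and f :: "'a \<Rightarrow> 'a"
  proof -
    have "(f ^^ c) 0 = 0" for c using that(2) by (induction c) auto
    then show ?thesis using that(1) by (auto simp: funpow_add fun_eq_iff)
  qed
  moreover have z: "\<delta> 0 = 0" "\<sigma> 0 = 0"
    using assms(1) unfolding left_skew_derivation_def by (metis add_cancel_right_right)+
  moreover from this have "twisted_derivation \<sigma> \<delta> 0 = 0"
    using assms(2) by (metis twisted_derivation_def bij_inv_eq_iff minus_zero)
  ultimately have "skew_data \<sigma> \<delta> (k + l)"
    using assms(1,2) kl by unfold_locales blast+
  then show ?thesis ..
qed

theorem ex1_skew_laurent_mult:
  assumes "left_skew_derivation \<sigma> \<delta>" "bij \<sigma>"
    and "nilpotent_map \<delta>" "nilpotent_map (twisted_derivation \<sigma> \<delta>)"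
  shows "\<exists>!mul. is_skew_laurent_mult \<sigma> \<delta> mul"
proof -
  obtain m where "skew_data \<sigma> \<delta> m" using skew_data_ex[OF assms] by blast
  then interpret skew_data \<sigma> \<delta> m .
  show ?thesis using is_skew_laurent_mult_lact mul_eq_lact by blast
qed

text \<open>Uniqueness needs that \<open>M\<close> is finite-dimensional, so that the elements \<open>y \<otimes> s\<close> generate
  \<open>M((X))\<close>; here \<open>M = F\<^sup>n\<close>.\<close>

theorem ex1_laurent_act:
  fixes scl :: "'f::field \<Rightarrow> 'a::ring_1 \<Rightarrow> 'a" and ract :: "'f ^ 'n \<Rightarrow> 'a \<Rightarrow> 'f ^ 'n"
  assumes "left_skew_derivation \<sigma> \<delta>" "bij \<sigma>"
    and "nilpotent_map \<delta>" "nilpotent_map (twisted_derivation \<sigma> \<delta>)"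
    and scl: "finite_dim_algebra scl"
    and r: "right_module (*) 1 ract" and scl_ract: "\<And>c v. ract v (scl c 1) = c *s v"
  shows "\<exists>!act. is_laurent_act \<sigma> \<delta> ract act"
proof -
  obtain m where "skew_data \<sigma> \<delta> m" using skew_data_ex[OF assms(1-4)] by blast
  then interpret skew_data \<sigma> \<delta> m .
  interpret vector_space scl using scl by (simp add: finite_dim_algebra_def)
  have "act = act'" if "is_laurent_act \<sigma> \<delta> ract act" "is_laurent_act \<sigma> \<delta> ract act'" for act act'
  proof (intro ext)
    fix v t
    define w where "w i = Abs_fls (\<lambda>n. scl ((v $$ n) $ i) 1)" for i :: 'n
    have w: "w i $$ n = scl ((v $$ n) $ i) 1" for i n
      unfolding w_def
    proof (rule nth_Abs_fls_ex_lower_bound)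
      obtain L where "\<forall>n<L. v $$ n = 0" using fls_bb by blast
      then show "\<exists>L. \<forall>n<L. scl ((v $$ n) $ i) 1 = 0" by (intro exI[of _ L]) simp
    qed
    have v: "v = (\<Sum>i\<in>UNIV. fls_tensor ract (axis i 1) (w i))"
      by (rule fls_eqI)
        (simp add: fls_nth_sum fls_tensor_nth[OF r] w scl_ract vec_eq_iff axis_def
          if_distrib sum.delta cong: if_cong)
    have "a v t = (\<Sum>i\<in>UNIV. fls_tensor ract (axis i 1) (skew_laurent_mult \<sigma> \<delta> (w i) t))"
      if a: "is_laurent_act \<sigma> \<delta> ract a" for a
    proof -
      interpret additive "\<lambda>x. a x t"
        using a by unfold_locales (simp add: is_laurent_act_def right_module_def)
      show ?thesis
        using a by (subst v, subst sum) (simp add: is_laurent_act_def)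
    qed
    with that show "act v t = act' v t" by metis
  qed
  then show ?thesis using is_laurent_act_lact[OF r] by blast
qed


section \<open>Convolutional codes\<close>

text \<open>The usual action of Laurent series over the field on Laurent series of vectors; in each
  coefficient only finitely many summands are nonzero.\<close>

definition fls_scale :: "'f::field fls \<Rightarrow> ('f ^ 'n) fls \<Rightarrow> ('f ^ 'n) fls" where
  "fls_scale s t = Abs_fls (\<lambda>k. \<Sum>i=fls_subdegree s..k - fls_subdegree t. s $$ i *s t $$ (k - i))"

definition poly_scale :: "'f::field poly \<Rightarrow> ('f ^ 'n) fls \<Rightarrow> ('f ^ 'n) fls" where
  "poly_scale p = fls_scale (fls_of_poly p)"

lemma fls_scale_nth_range:
  assumes "\<And>i. i < a \<Longrightarrow> s $$ i = 0" "\<And>i. i > b \<Longrightarrow> t $$ (k - i) = 0"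
  shows "fls_scale s t $$ k = (\<Sum>i=a..b. s $$ i *s t $$ (k - i))"
proof -
  have "fls_scale s t $$ k = (\<Sum>i=fls_subdegree s..k - fls_subdegree t. s $$ i *s t $$ (k - i))"
    unfolding fls_scale_def
    by (rule nth_Abs_fls_ex_lower_bound) (rule exI[of _ "fls_subdegree s + fls_subdegree t"], auto)
  also have "\<dots> = (\<Sum>i\<in>{a..b} \<inter> {fls_subdegree s..k - fls_subdegree t}. s $$ i *s t $$ (k - i))"
    using assms by (intro sum.mono_neutral_right) (auto simp: not_le)
  also have "\<dots> = (\<Sum>i=a..b. s $$ i *s t $$ (k - i))"
    by (intro sum.mono_neutral_left) (auto simp: not_le)
  finally show ?thesis .
qed

definition fls_component :: "('f::zero ^ 'n) fls \<Rightarrow> 'n \<Rightarrow> 'f fls" where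
  "fls_component t c = Abs_fls (\<lambda>k. (t $$ k) $ c)"

lemma fls_component_nth [simp]: "fls_component t c $$ k = (t $$ k) $ c"
  unfolding fls_component_def
  by (rule nth_Abs_fls_ex_lower_bound) (rule exI[of _ "fls_subdegree t"], simp)

lemma fls_component_eqI: "(\<And>c. fls_component t c = fls_component u c) \<Longrightarrow> t = u"
  by (simp add: fls_eq_iff vec_eq_iff)

lemma fls_component_add [simp]:
  "fls_component (t + u) c = fls_component t c + fls_component (u :: ('f::monoid_add ^ 'n) fls) c"
  by (simp add: fls_eq_iff)

lemma fls_component_scale [simp]: "fls_component (fls_scale s t) c = s * fls_component t c"
proof (rule fls_eqI)
  fix k
  let ?u = "fls_component t c"
  have "fls_component (fls_scale s t) c $$ k =
      (\<Sum>i=fls_subdegree s..k - fls_subdegree t. s $$ i * ?u $$ (k - i))"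
    by (simp add: fls_scale_nth_range[of "fls_subdegree s" s "k - fls_subdegree t"])
  also have "\<dots> = (\<Sum>i=fls_subdegree s..k - fls_subdegree ?u. s $$ i * ?u $$ (k - i))"
  proof (cases "?u = 0")
    case False
    then have "fls_subdegree t \<le> fls_subdegree ?u"
      by (intro fls_subdegree_geI) simp_all
    moreover have "?u $$ (k - i) = 0" if "i > k - fls_subdegree ?u" for i
      using that by (intro fls_eq0_below_subdegree) simp
    ultimately show ?thesis by (intro sum.mono_neutral_right) (auto simp: not_le)
  qed simp
  also have "\<dots> = (s * ?u) $$ k" by (simp only: fls_times_nth(2))
  finally show "fls_component (fls_scale s t) c $$ k = (s * ?u) $$ k" .
qed

interpretation laurent: vector_space "fls_scale :: 'f::field fls \<Rightarrow> ('f ^ 'n) fls \<Rightarrow> ('f ^ 'n) fls"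
  by standard (rule fls_component_eqI; simp add: algebra_simps)+

lemma fls_of_poly_add: "fls_of_poly (p + q) = fls_of_poly p + fls_of_poly (q :: 'f::field poly)"
  by (simp add: fls_of_poly_def fps_of_poly_add fps_to_fls_plus)

lemma fls_of_poly_mult: "fls_of_poly (p * q) = fls_of_poly p * fls_of_poly (q :: 'f::field poly)"
  by (simp add: fls_of_poly_def fps_of_poly_mult fls_times_fps_to_fls)

interpretation polyn: module "poly_scale :: 'f::field poly \<Rightarrow> ('f ^ 'n) fls \<Rightarrow> ('f ^ 'n) fls"
  by standard (simp_all add: poly_scale_def fls_of_poly_add fls_of_poly_mult
      laurent.scale_left_distrib laurent.scale_right_distrib, simp add: fls_of_poly_def)

text \<open>\<open>F\<^sup>n[X]\<close> is regarded as a subset of \<open>F\<^sup>n((X))\<close>, and its module structures over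
  \<open>F[X]\<close> and over the skew polynomial ring are those restricted from \<open>F\<^sup>n((X))\<close>.\<close>

definition poly_vecs :: "('f::field ^ 'n) fls set" where
  "poly_vecs = range fls_of_poly"

text \<open>The dimension of the vector space \<open>D\<close> is the size of the finite basis \<open>B\<close>.\<close>

definition convolutional_code :: "nat \<Rightarrow> ('f::field ^ 'n) fls set \<Rightarrow> bool" where
  "convolutional_code k D \<longleftrightarrow>
     laurent.subspace D \<and>
     (\<exists>B\<subseteq>poly_vecs. finite B \<and> card B = k \<and> laurent.independent B \<and> laurent.span B = D)"

definition cyclic_code ::
  "('a::ring_1 \<Rightarrow> 'a) \<Rightarrow> ('a \<Rightarrow> 'a) \<Rightarrow> ('f::field ^ 'n \<Rightarrow> 'a \<Rightarrow> 'f ^ 'n) \<Rightarrow> nat \<Rightarrow> ('f ^ 'n) fls set \<Rightarrow> bool"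
  where
  "cyclic_code \<sigma> \<delta> ract k D \<longleftrightarrow>
     convolutional_code k D \<and> right_submodule (range fls_const) (laurent_act \<sigma> \<delta> ract) D"

definition skew_poly_submodule ::
  "('a::ring_1 \<Rightarrow> 'a) \<Rightarrow> ('a \<Rightarrow> 'a) \<Rightarrow> ('f::field ^ 'n \<Rightarrow> 'a \<Rightarrow> 'f ^ 'n) \<Rightarrow> ('f ^ 'n) fls set \<Rightarrow> bool"
  where
  "skew_poly_submodule \<sigma> \<delta> ract N \<longleftrightarrow>
     N \<subseteq> poly_vecs \<and> right_submodule (range fls_of_poly) (laurent_act \<sigma> \<delta> ract) N"

definition direct_summand :: "('f::field ^ 'n) fls set \<Rightarrow> bool" where
  "direct_summand N \<longleftrightarrow>
     polyn.subspace N \<and>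
     (\<exists>Q. polyn.subspace Q \<and> N \<inter> Q = {0} \<and> {x + y |x y. x \<in> N \<and> y \<in> Q} = poly_vecs)"

definition free_of_rank :: "nat \<Rightarrow> ('f::field ^ 'n) fls set \<Rightarrow> bool" where
  "free_of_rank k N \<longleftrightarrow>
     (\<exists>B. finite B \<and> card B = k \<and> polyn.independent B \<and> polyn.span B = N)"

end

theory Submission
  imports Defs
begin

text \<open>The inverse map sends \<open>N\<close> to its \<open>F((X))\<close>-span.  For a code \<open>D\<close>, Euclid's algorithm in
  \<open>F[X]\<close> yields a basis of \<open>F[X]\<^sup>n\<close> that contains a basis of \<open>D \<inter> F[X]\<^sup>n\<close>.  For a direct
  summand \<open>N\<close>, the coordinate functions of a basis of \<open>N\<close> extend to \<open>F((X))\<close>-linear functions on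
  \<open>F((X))\<^sup>n\<close> that are \<open>F[X]\<close>-valued on \<open>F[X]\<^sup>n\<close>, so the span of \<open>N\<close> contains no further polynomial
  vector.  Cyclicity transfers because an \<open>F\<close>-basis \<open>b\<^sub>1, \<dots>, b\<^sub>d\<close> of \<open>A\<close> allows writing each
  element of \<open>A((X;\<sigma>,\<delta>))\<close> as \<open>\<Sum>\<^sub>i b\<^sub>i s\<^sub>i\<close> with \<open>s\<^sub>i \<in> F((X))\<close>: the \<open>F((X))\<close>-span of a set
  closed under \<open>A\<close> is closed under the whole skew Laurent series ring.\<close>

section \<open>Polynomial vectors\<close>

lemma nth_fls_of_poly: "fls_of_poly p $$ n = (if n < 0 then 0 else coeff p (nat n))"
  by (simp add: fls_of_poly_def)

lemma fls_of_poly_eq_0_iff [simp]: "fls_of_poly p = 0 \<longleftrightarrow> p = 0"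
  by (simp add: fls_of_poly_def)

lemma fls_of_poly_1: "fls_of_poly (1 :: 'f::field poly) = 1"
  by (simp add: fls_of_poly_def)

lemma fls_of_poly_sum:
  "fls_of_poly (\<Sum>i\<in>I. p i) = (\<Sum>i\<in>I. fls_of_poly (p i :: 'f::field poly))"
  by (induction I rule: infinite_finite_induct) (simp_all add: fls_of_poly_add)

lemma fls_const_eq_fls_of_poly: "fls_const a = fls_of_poly [:a:]"
  by (rule fls_eqI) (auto simp: nth_fls_of_poly coeff_pCons split: nat.split)

text \<open>Finite support is the form in which closure properties of \<open>poly_vecs\<close> are
  checked coefficientwise; the coefficient type is arbitrary, so scalars and vectors are both
  covered.\<close>

lemma range_fls_of_poly_iff:
  "s \<in> range fls_of_poly \<longleftrightarrow> (\<exists>N. \<forall>n. n < 0 \<or> n > N \<longrightarrow> s $$ n = 0)"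
proof
  assume "s \<in> range fls_of_poly"
  then obtain p where "s = fls_of_poly p" by blast
  then show "\<exists>N. \<forall>n. n < 0 \<or> n > N \<longrightarrow> s $$ n = 0"
    by (intro exI[of _ "int (degree p)"]) (auto simp: nth_fls_of_poly intro!: coeff_eq_0)
next
  assume "\<exists>N. \<forall>n. n < 0 \<or> n > N \<longrightarrow> s $$ n = 0"
  then obtain N where N: "\<And>n. n < 0 \<or> n > N \<Longrightarrow> s $$ n = 0" by blast
  have "coeff (Abs_poly (\<lambda>i. s $$ int i)) = (\<lambda>i. s $$ int i)"
    by (rule coeff_Abs_poly[of "nat N"]) (auto intro!: N)
  then have "s = fls_of_poly (Abs_poly (\<lambda>i. s $$ int i))"
    by (intro fls_eqI) (auto simp: nth_fls_of_poly N)
  then show "s \<in> range fls_of_poly" by blast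
qed

lemma fls_component_0 [simp]: "fls_component 0 c = 0"
  by (rule fls_eqI) simp

lemma fls_component_sum:
  "fls_component (\<Sum>i\<in>I. t i) c = (\<Sum>i\<in>I. fls_component (t i :: ('f::field ^ 'n) fls) c)"
  by (induction I rule: infinite_finite_induct) simp_all

lemma poly_vecs_component:
  assumes "v \<in> poly_vecs"
  shows "fls_component v c \<in> range fls_of_poly"
  using assms unfolding poly_vecs_def range_fls_of_poly_iff by (metis fls_component_nth zero_index)

section \<open>The standard basis\<close>

definition std_vec :: "'n \<Rightarrow> ('f::field ^ 'n) fls" where
  "std_vec i = fls_const (axis i 1)"

lemma fls_component_std_vec: "fls_component (std_vec i) c = (if c = i then 1 else 0)"
  by (rule fls_eqI) (auto simp: std_vec_def axis_def)

text \<open>The coordinates are the components, which are polynomials when \<open>v\<close> is a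
  polynomial vector; one expansion thus serves \<open>F((X))\<close> and
  \<open>F[X]\<close>.\<close>

lemma std_vec_expansion: "v = (\<Sum>i\<in>UNIV. fls_scale (fls_component v i) (std_vec i))"
  by (rule fls_component_eqI)
    (simp add: fls_component_sum fls_component_std_vec if_distrib cong: if_cong)

lemma inj_std_vec: "inj std_vec"
  by (rule injI) (metis fls_component_std_vec zero_neq_one)

lemma independent_std_vec: "laurent.independent (range std_vec :: ('f::field ^ 'n) fls set)"
proof
  assume "laurent.dependent (range std_vec :: ('f ^ 'n) fls set)"
  then obtain u where u: "\<exists>v\<in>range std_vec. u v \<noteq> 0"
    "(\<Sum>v\<in>range std_vec. fls_scale (u v) v) = (0 :: ('f ^ 'n) fls)"
    by (subst (asm) laurent.dependent_finite) auto
  have "(\<Sum>i\<in>UNIV. fls_scale (u (std_vec i)) (std_vec i)) = (0 :: ('f ^ 'n) fls)"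
    using u(2) by (simp add: sum.reindex inj_std_vec)
  then have "fls_component (\<Sum>i\<in>UNIV. fls_scale (u (std_vec i)) (std_vec i)) c = 0" for c :: 'n
    by simp
  then have "u (std_vec c) = 0" for c
    by (simp add: fls_component_sum fls_component_std_vec if_distrib cong: if_cong)
  then show False using u(1) by blast
qed

lemma subspace_poly_vecs: "polyn.subspace (poly_vecs :: ('f::field ^ 'n) fls set)"
proof (rule polyn.subspaceI)
  fix x y :: "('f ^ 'n) fls" assume "x \<in> poly_vecs" "y \<in> poly_vecs"
  then obtain M N where "\<forall>n. n < 0 \<or> n > M \<longrightarrow> x $$ n = 0" "\<forall>n. n < 0 \<or> n > N \<longrightarrow> y $$ n = 0"
    unfolding poly_vecs_def range_fls_of_poly_iff by blast
  then show "x + y \<in> poly_vecs"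
    unfolding poly_vecs_def range_fls_of_poly_iff by (intro exI[of _ "max M N"]) auto
next
  fix x :: "('f ^ 'n) fls" and p assume "x \<in> poly_vecs"
  then obtain N where N: "\<forall>n. n < 0 \<or> n > N \<longrightarrow> x $$ n = 0"
    unfolding poly_vecs_def range_fls_of_poly_iff by blast
  have eq: "poly_scale p x $$ n = (\<Sum>i=0..n. fls_of_poly p $$ i *s x $$ (n - i))" for n
    unfolding poly_scale_def
    by (rule fls_scale_nth_range) (use N in \<open>auto simp: nth_fls_of_poly\<close>)
  \<comment> \<open>For \<open>n\<close> beyond \<open>degree p + N\<close>, either \<open>i\<close>
    exceeds the degree of \<open>p\<close> or \<open>n - i\<close> exceeds \<open>N\<close>.\<close>
  have "fls_of_poly p $$ i *s x $$ (n - i) = 0" if "n > int (degree p) + N" for n i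
    using that N by (cases "i > int (degree p)") (auto simp: nth_fls_of_poly coeff_eq_0)
  then have "poly_scale p x $$ n = 0" if "n < 0 \<or> n > int (degree p) + N" for n
    using that unfolding eq by (intro sum.neutral) auto
  then show "poly_scale p x \<in> poly_vecs"
    unfolding poly_vecs_def range_fls_of_poly_iff by blast
qed (auto simp: poly_vecs_def range_fls_of_poly_iff)

lemma span_std_vec: "polyn.span (range std_vec) = (poly_vecs :: ('f::field ^ 'n) fls set)"
proof (rule polyn.span_subspace)
  show "range std_vec \<subseteq> (poly_vecs :: ('f ^ 'n) fls set)"
    by (auto simp: std_vec_def fls_const_eq_fls_of_poly poly_vecs_def)
  show "(poly_vecs :: ('f ^ 'n) fls set) \<subseteq> polyn.span (range std_vec)"
  proof
    fix v :: "('f ^ 'n) fls" assume "v \<in> poly_vecs"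
    then have "\<exists>p. fls_component v i = fls_of_poly p" for i
      using poly_vecs_component by blast
    then obtain p where p: "\<And>i. fls_component v i = fls_of_poly (p i)" by metis
    have "v = (\<Sum>i\<in>UNIV. poly_scale (p i) (std_vec i))"
      by (subst std_vec_expansion) (simp add: p poly_scale_def)
    also have "\<dots> \<in> polyn.span (range std_vec)"
      by (intro polyn.span_sum polyn.span_scale polyn.span_base) blast
    finally show "v \<in> polyn.span (range std_vec)" .
  qed
qed (rule subspace_poly_vecs)

section \<open>Comparison of \<open>F[X]\<close>-spans and \<open>F((X))\<close>-spans\<close>

lemma laurent_subspace_imp_polyn: "laurent.subspace D \<Longrightarrow> polyn.subspace D"
  by (auto simp: polyn.subspace_def laurent.subspace_def poly_scale_def)

lemma polyn_span_subset_laurent_span: "polyn.span S \<subseteq> laurent.span S"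
  by (intro polyn.span_minimal laurent.span_superset laurent_subspace_imp_polyn laurent.subspace_span)

lemma laurent_span_polyn_span: "laurent.span (polyn.span S) = laurent.span S"
  by (rule laurent.span_subspace)
    (auto intro: subsetD[OF polyn_span_subset_laurent_span]
      subsetD[OF laurent.span_mono[OF polyn.span_superset]])

lemma laurent_independent_imp_polyn:
  assumes "laurent.independent B"
  shows "polyn.independent B"
  unfolding polyn.independent_explicit_module
proof (intro allI impI)
  fix t u v assume "finite t" "t \<subseteq> B" "(\<Sum>v\<in>t. poly_scale (u v) v) = 0" "v \<in> t"
  then have "fls_of_poly (u v) = 0"
    using laurent.independentD[OF assms, of t "\<lambda>v. fls_of_poly (u v)"] by (simp add: poly_scale_def)
  then show "u v = 0" by simp
qed

text \<open>A nonzero polynomial is invertible in \<open>F((X))\<close>. Hence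
  \<open>D \<inter> poly_vecs\<close> is a saturated submodule, the property that makes it a direct
  summand.\<close>

lemma poly_scale_cancel:
  assumes "laurent.subspace D" "poly_scale p v \<in> D" "p \<noteq> 0"
  shows "v \<in> D"
proof -
  have "fls_scale (inverse (fls_of_poly p)) (poly_scale p v) \<in> D"
    using assms by (intro laurent.subspace_scale)
  then show ?thesis using assms(3) by (simp add: poly_scale_def)
qed


section \<open>Bases adapted to a subspace\<close>

text \<open>Euclid's algorithm on the coefficients of an element of \<open>D\<close>: if the coefficients at \<open>c\<close> and
  \<open>d\<close> are nonzero, replacing \<open>d\<close> by \<open>d + q c\<close> reduces the former modulo the latter.\<close>

lemma basis_change_meets_subspace:
  fixes D :: "('f::field ^ 'n) fls set"
  assumes "laurent.subspace D" "finite C" "laurent.independent C"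
    and "(\<Sum>c\<in>C. poly_scale (r c) c) \<in> D" "c0 \<in> C" "r c0 \<noteq> 0"
  shows "\<exists>C'. finite C' \<and> card C' = card C \<and> laurent.independent C' \<and>
    polyn.span C' = polyn.span C \<and> C' \<inter> D \<noteq> {}"
  using assms(2-)
\<comment> \<open>Zero counts 0 and a nonzero polynomial counts its degree plus one, so replacing a
  nonzero constant by 0 also decreases the measure.\<close>
proof (induction "\<Sum>c\<in>C. if r c = 0 then 0 else Suc (degree (r c))" arbitrary: C r c0
    rule: less_induct)
  case less
  let ?g = "\<lambda>p :: 'f poly. if p = 0 then 0 else Suc (degree p)"
  show ?case
  proof (cases "\<exists>c\<in>C. \<exists>d\<in>C. c \<noteq> d \<and> r c \<noteq> 0 \<and> r d \<noteq> 0 \<and> degree (r d) \<le> degree (r c)")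
    case True
    then obtain c d where cd: "c \<in> C" "d \<in> C" "c \<noteq> d" "r c \<noteq> 0" "r d \<noteq> 0"
      "degree (r d) \<le> degree (r c)" by blast
    define q where "q = r c div r d"
    define d' where "d' = d + poly_scale q c"
    define B where "B = C - {d}"
    \<comment> \<open>\<open>d'\<close> inherits the coefficient of \<open>d\<close>; since
      \<open>r c = r d * q + r c mod r d\<close>, the combination over the new family is the same
      vector.\<close>
    define r' where "r' x = (if x = d' then r d else if x = c then r c mod r d else r x)" for x
    have B: "finite B" "c \<in> B" "d \<notin> B" "C = insert d B" "laurent.independent B"
      using less.prems cd laurent.independent_mono[of C "C - {d}"] by (auto simp: B_def)
    have d: "d \<notin> laurent.span B"
      using less.prems(2) cd(2) laurent.dependent_def unfolding B_def by blast
    have qc: "poly_scale q c \<in> polyn.span B"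
      using B by (intro polyn.span_scale polyn.span_base)
    then have "poly_scale q c \<in> laurent.span B"
      using polyn_span_subset_laurent_span by blast
    with d have d': "d' \<notin> laurent.span B"
      unfolding d'_def by (simp add: laurent.span_add_eq2)
    then have d'B: "d' \<notin> B" using laurent.span_base by blast
    have r'B: "r' x = (if x = c then r c mod r d else r x)" if "x \<in> B" for x
      using that d'B by (auto simp: r'_def)
    have r'd: "r' d' = r d" by (simp add: r'_def)
    have "(\<Sum>x\<in>B. poly_scale (r' x) x) =
        poly_scale (r c mod r d) c + (\<Sum>x\<in>B - {c}. poly_scale (r x) x)"
      using B by (simp add: sum.remove[of B c] r'B)
    moreover have "(\<Sum>x\<in>C. poly_scale (r x) x) =
        poly_scale (r d) d + (poly_scale (r c) c + (\<Sum>x\<in>B - {c}. poly_scale (r x) x))"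
      using B by (simp add: sum.remove[of B c])
    moreover have "poly_scale (r d) d' + poly_scale (r c mod r d) c =
        poly_scale (r d) d + poly_scale (r c) c"
    proof -
      have "r c = r d * q + r c mod r d" by (simp add: q_def)
      then have "poly_scale (r c) c = poly_scale (r d * q) c + poly_scale (r c mod r d) c"
        by (metis polyn.scale_left_distrib)
      then show ?thesis by (simp add: d'_def polyn.scale_right_distrib)
    qed
    ultimately have sum: "(\<Sum>x\<in>insert d' B. poly_scale (r' x) x) = (\<Sum>x\<in>C. poly_scale (r x) x)"
      using B d'B by (simp add: r'd add.assoc[symmetric])
    have g: "?g (r c mod r d) < ?g (r c)"
      using cd degree_mod_less[of "r d" "r c"] by auto
    have "(\<Sum>x\<in>insert d' B. ?g (r' x)) = ?g (r d) + (?g (r c mod r d) + (\<Sum>x\<in>B - {c}. ?g (r x)))"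
    proof -
      have "(\<Sum>x\<in>B - {c}. ?g (r' x)) = (\<Sum>x\<in>B - {c}. ?g (r x))"
        by (intro sum.cong) (auto simp: r'B)
      then show ?thesis using B d'B by (simp add: r'd sum.remove[of B c] r'B)
    qed
    also have "\<dots> < ?g (r d) + (?g (r c) + (\<Sum>x\<in>B - {c}. ?g (r x)))"
      using g by simp
    also have "\<dots> = (\<Sum>x\<in>C. ?g (r x))"
      using B by (simp add: sum.remove[of B c])
    finally have less_sum: "(\<Sum>x\<in>insert d' B. ?g (r' x)) < (\<Sum>x\<in>C. ?g (r x))" .
    obtain C' where C': "finite C'" "card C' = card (insert d' B)"
      "laurent.independent C'" "polyn.span C' = polyn.span (insert d' B)" "C' \<inter> D \<noteq> {}"
    proof -
      have "(\<Sum>x\<in>insert d' B. poly_scale (r' x) x) \<in> D"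
        unfolding sum by (rule less.prems)
      moreover have "laurent.independent (insert d' B)"
        using d' B(5) by (rule laurent.independent_insertI)
      ultimately show thesis
        using less.hyps[OF less_sum, of d'] that B(1) r'd cd(5) by auto
    qed
    have "polyn.span (insert d' B) = polyn.span C"
      unfolding B(4) by (rule polyn.eq_span_insert_eq) (simp add: d'_def qc)
    then show ?thesis using C' B d'B by (intro exI[of _ C']) simp
  next
    case False
    then have no_pair: "degree (r c) < degree (r d)"
      if "c \<in> C" "d \<in> C" "c \<noteq> d" "r c \<noteq> 0" "r d \<noteq> 0" for c d
      using that by (meson not_le)
    \<comment> \<open>Strict inequality in both directions is impossible, so \<open>c0\<close>
      carries the only nonzero coefficient and the given vector of \<open>D\<close> is a multiple of
      \<open>c0\<close>.\<close>
    have r0: "r c = 0" if "c \<in> C" "c \<noteq> c0" for c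
      using no_pair[of c c0] no_pair[of c0 c] that less.prems(4,5) by (cases "r c = 0") auto
    have "(\<Sum>c\<in>C. poly_scale (r c) c) = poly_scale (r c0) c0 + (\<Sum>c\<in>C - {c0}. poly_scale (r c) c)"
      using less.prems(1,4) by (rule sum.remove)
    also have "(\<Sum>c\<in>C - {c0}. poly_scale (r c) c) = 0"
      by (intro sum.neutral) (simp add: r0)
    finally have "(\<Sum>c\<in>C. poly_scale (r c) c) = poly_scale (r c0) c0" by simp
    then have "poly_scale (r c0) c0 \<in> D" using less.prems(3) by simp
    then have "c0 \<in> D" using less.prems(5) by (rule poly_scale_cancel[OF assms(1)])
    then show ?thesis using less.prems by blast
  qed
qed

text \<open>Induction on \<open>card C\<close>, splitting off one basis vector lying in
  \<open>D\<close> at a time. This is the adapted basis theorem for submodules of a free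
  \<open>F[X]\<close>-module, with all elementary divisors 1 because \<open>D\<close> is closed
  under division by nonzero polynomials.\<close>

lemma adapted_basis:
  fixes D :: "('f::field ^ 'n) fls set"
  assumes D: "laurent.subspace D" and "finite C" "laurent.independent C"
  shows "\<exists>B1 B2. finite B1 \<and> finite B2 \<and> B1 \<inter> B2 = {} \<and> laurent.independent (B1 \<union> B2) \<and>
    polyn.span (B1 \<union> B2) = polyn.span C \<and> polyn.span B1 = D \<inter> polyn.span C"
  using assms(2-)
proof (induction "card C" arbitrary: C rule: less_induct)
  case less
  have D': "polyn.subspace D" using D by (rule laurent_subspace_imp_polyn)
  show ?case
  proof (cases "D \<inter> polyn.span C \<subseteq> {0}")
    case True
    then have "D \<inter> polyn.span C = {0}"
      using polyn.subspace_0[OF D'] polyn.span_zero by blast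
    then show ?thesis using less.prems by (intro exI[of _ "{}"] exI[of _ C]) simp
  next
    case False
    then obtain v where v: "v \<in> D" "v \<in> polyn.span C" "v \<noteq> 0" by blast
    then obtain r where r: "v = (\<Sum>c\<in>C. poly_scale (r c) c)"
      using polyn.span_finite[OF less.prems(1)] by blast
    have "\<exists>c0\<in>C. r c0 \<noteq> 0"
    proof (rule ccontr)
      assume "\<not> ?thesis"
      then have "v = 0" unfolding r by (intro sum.neutral) simp
      with v(3) show False ..
    qed
    then obtain c0 where "c0 \<in> C" "r c0 \<noteq> 0" by blast
    moreover have "(\<Sum>c\<in>C. poly_scale (r c) c) \<in> D" using v(1) r by simp
    ultimately obtain C' c where C': "finite C'" "card C' = card C" "laurent.independent C'"
      "polyn.span C' = polyn.span C" "c \<in> C'" "c \<in> D"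
      using basis_change_meets_subspace[OF D less.prems] by blast
    let ?C = "C' - {c}"
    have "card ?C < card C" using C' by (metis card_Diff1_less)
    moreover have "laurent.independent ?C" by (rule laurent.independent_mono[OF C'(3)]) blast
    ultimately obtain B1 B2 where B: "finite B1" "finite B2" "B1 \<inter> B2 = {}"
      "laurent.independent (B1 \<union> B2)" "polyn.span (B1 \<union> B2) = polyn.span ?C"
      "polyn.span B1 = D \<inter> polyn.span ?C"
      using less.hyps[of ?C] C' by blast
    have c: "c \<notin> laurent.span (B1 \<union> B2)"
      using C' B(5) laurent.dependent_def laurent_span_polyn_span by metis
    then have c': "c \<notin> B1 \<union> B2" using laurent.span_base by blast
    have C: "x \<in> polyn.span C \<longleftrightarrow> (\<exists>k. x - poly_scale k c \<in> polyn.span ?C)" for x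
      using polyn.span_breakdown_eq[of x c ?C] C' by (simp add: insert_absorb)
    \<comment> \<open>As \<open>c\<close> lies in \<open>D\<close>, subtracting multiples of
      \<open>c\<close> does not affect membership in \<open>D\<close>; so
      \<open>D \<inter> polyn.span C\<close> is generated by \<open>c\<close> and its part inside
      \<open>polyn.span ?C\<close>.\<close>
    have "x - poly_scale k c \<in> D \<longleftrightarrow> x \<in> D" for x k
      using polyn.subspace_add[OF D', of "x - poly_scale k c" "poly_scale k c"]
        polyn.subspace_diff[OF D'] polyn.subspace_scale[OF D' C'(6)] by auto
    then have "polyn.span (insert c B1) = D \<inter> polyn.span C"
      by (auto simp: polyn.span_breakdown_eq B(6) C)
    moreover have "polyn.span (insert c (B1 \<union> B2)) = polyn.span C"
      by (auto simp: polyn.span_breakdown_eq B(5) C)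
    moreover have "laurent.independent (insert c (B1 \<union> B2))"
      using c B(4) by (rule laurent.independent_insertI)
    ultimately show ?thesis
      using B(1-3) c' by (intro exI[of _ "insert c B1"] exI[of _ B2]) simp
  qed
qed


section \<open>Codes and direct summands\<close>

text \<open>The generators \<open>B\<close> already lie in the intersection.\<close>

lemma laurent_span_Int_poly_vecs:
  assumes "laurent.subspace D" "B \<subseteq> poly_vecs" "laurent.span B = D"
  shows "laurent.span (D \<inter> poly_vecs) = D"
  using assms laurent.span_base[of _ B]
  by (intro laurent.span_subspace) (auto intro: subsetD[OF laurent.span_mono[of B]])

text \<open>Adapt the standard basis of \<open>F[X]^n\<close> to \<open>D\<close>: \<open>B1\<close>
  is a basis of the intersection and \<open>B2\<close> spans a complement. The rank is
  \<open>k\<close> because \<open>B1\<close> is also an \<open>F((X))\<close>-basis of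
  \<open>D\<close>.\<close>

lemma convolutional_code_Int_poly_vecs:
  assumes "convolutional_code k D"
  shows "direct_summand (D \<inter> poly_vecs)" "free_of_rank k (D \<inter> poly_vecs)"
    "laurent.span (D \<inter> poly_vecs) = D"
proof -
  obtain B where D: "laurent.subspace D" and B: "B \<subseteq> poly_vecs" "finite B" "card B = k"
    "laurent.independent B" "laurent.span B = D"
    using assms unfolding convolutional_code_def by blast
  show span: "laurent.span (D \<inter> poly_vecs) = D"
    by (rule laurent_span_Int_poly_vecs[OF D B(1,5)])
  obtain B1 B2 where C: "finite B1" "finite B2" "B1 \<inter> B2 = {}" "laurent.independent (B1 \<union> B2)"
    "polyn.span (B1 \<union> B2) = poly_vecs" "polyn.span B1 = D \<inter> poly_vecs"
    using adapted_basis[OF D _ independent_std_vec] by (auto simp: span_std_vec)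
  have i1: "laurent.independent B1" by (rule laurent.independent_mono[OF C(4)]) simp
  have s1: "laurent.span B1 = D" using laurent_span_polyn_span[of B1] C span by simp
  have "card B1 = k"
    using laurent.dim_span_eq_card_independent[OF i1] laurent.dim_span_eq_card_independent[OF B(4)]
    by (simp add: s1 B)
  then show "free_of_rank k (D \<inter> poly_vecs)"
    unfolding free_of_rank_def using C i1 laurent_independent_imp_polyn by blast
  have "polyn.span B1 \<inter> polyn.span B2 = {0}"
  proof -
    have "x = 0" if x: "x \<in> polyn.span B1" "x \<in> polyn.span B2" for x
    proof -
      obtain u w where u: "x = (\<Sum>b\<in>B1. poly_scale (u b) b)" and w: "x = (\<Sum>b\<in>B2. poly_scale (w b) b)"
        using x unfolding polyn.span_finite[OF C(1)] polyn.span_finite[OF C(2)] by blast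
      \<comment> \<open>Subtracting the two expansions of \<open>x\<close> gives one relation over
        the disjoint union.\<close>
      let ?t = "\<lambda>b. if b \<in> B1 then u b else - w b"
      have "(\<Sum>b\<in>B1 \<union> B2. poly_scale (?t b) b) =
          (\<Sum>b\<in>B1. poly_scale (u b) b) + (\<Sum>b\<in>B2. poly_scale (- w b) b)"
        using C by (subst sum.union_disjoint) (auto intro!: arg_cong2[of _ _ _ _ "(+)"] sum.cong)
      also have "\<dots> = 0"
        using u w by (simp add: sum_negf)
      finally have "(\<Sum>b\<in>B1 \<union> B2. poly_scale (?t b) b) = 0" .
      from polyn.independentD[OF laurent_independent_imp_polyn[OF C(4)] _ _ this]
      have "u b = 0" if "b \<in> B1" for b using that C by force
      then show ?thesis using u by simp
    qed
    then show ?thesis using polyn.span_zero by blast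
  qed
  moreover have "{x + y |x y. x \<in> polyn.span B1 \<and> y \<in> polyn.span B2} = poly_vecs"
    using C(5) polyn.span_Un by blast
  ultimately show "direct_summand (D \<inter> poly_vecs)"
    unfolding direct_summand_def C(6)[symmetric] using polyn.subspace_span by blast
qed

text \<open>The coordinate functions of \<open>N\<close> extend to \<open>F[X]\<^sup>n\<close> along the projection onto the summand,
  and then by linearity to \<open>F((X))\<^sup>n\<close>.\<close>

lemma direct_summand_dual_basis:
  fixes N :: "('f::field ^ 'n) fls set"
  assumes "direct_summand N" "finite C" "polyn.independent C" "polyn.span C = N"
  obtains \<kappa> where "\<And>c. Vector_Spaces.linear fls_scale (*) (\<kappa> c)"
    "\<And>b c. b \<in> C \<Longrightarrow> c \<in> C \<Longrightarrow> \<kappa> c b = (if b = c then 1 else 0)"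
    "\<And>c v. v \<in> poly_vecs \<Longrightarrow> \<kappa> c v \<in> range fls_of_poly"
proof -
  obtain Q where Q: "polyn.subspace Q" "N \<inter> Q = {0}" "{x + y |x y. x \<in> N \<and> y \<in> Q} = poly_vecs"
    and N: "polyn.subspace N"
    using assms(1) unfolding direct_summand_def by blast
  have "\<exists>x y. std_vec i = x + y \<and> x \<in> N \<and> y \<in> Q" for i
  proof -
    have "std_vec i \<in> poly_vecs"
      using polyn.span_base[of "std_vec i" "range std_vec"] by (simp add: span_std_vec)
    then show ?thesis using Q(3) by blast
  qed
  \<comment> \<open>\<open>x i\<close> is the projection of the \<open>i\<close>-th standard vector
    to \<open>N\<close> along \<open>Q\<close>.\<close>
  then obtain x y where xy: "\<And>i. std_vec i = x i + y i" "\<And>i. x i \<in> N" "\<And>i. y i \<in> Q" by metis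
  have "\<exists>r. x i = (\<Sum>c\<in>C. poly_scale (r c) c)" for i
    using xy(2)[of i] polyn.span_finite[OF assms(2)] assms(4) by blast
  then obtain r where r: "\<And>i. x i = (\<Sum>c\<in>C. poly_scale (r i c) c)" by metis
  \<comment> \<open>\<open>r i c\<close> is the \<open>c\<close>-coordinate of that projection;
    weighting by the components of \<open>v\<close> extends it linearly.\<close>
  define \<kappa> where "\<kappa> c v = (\<Sum>i\<in>UNIV. fls_component v i * fls_of_poly (r i c))" for c v
  show ?thesis
  proof
    fix c
    show "Vector_Spaces.linear fls_scale (*) (\<kappa> c)"
      by unfold_locales
        (simp_all add: \<kappa>_def algebra_simps sum.distrib sum_distrib_left)
  next
    fix c and v :: "('f ^ 'n) fls" assume "v \<in> poly_vecs"
    then have "\<exists>p. fls_component v i = fls_of_poly p" for i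
      using poly_vecs_component by blast
    then obtain p where "\<And>i. fls_component v i = fls_of_poly (p i)" by metis
    then have "\<kappa> c v = fls_of_poly (\<Sum>i\<in>UNIV. p i * r i c)"
      by (simp add: \<kappa>_def fls_of_poly_sum fls_of_poly_mult)
    then show "\<kappa> c v \<in> range fls_of_poly" by blast
  next
    fix b c assume bc: "b \<in> C" "c \<in> C"
    then have bN: "b \<in> N" using assms(4) polyn.span_base by blast
    then have "b \<in> poly_vecs" using Q(3) polyn.subspace_0[OF Q(1)] by force
    then have "\<exists>p. fls_component b i = fls_of_poly p" for i
      using poly_vecs_component by blast
    then obtain p where p: "\<And>i. fls_component b i = fls_of_poly (p i)" by metis
    let ?x = "\<Sum>i\<in>UNIV. poly_scale (p i) (x i)" and ?y = "\<Sum>i\<in>UNIV. poly_scale (p i) (y i)"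
    have "b = (\<Sum>i\<in>UNIV. poly_scale (p i) (std_vec i))"
      by (subst std_vec_expansion) (simp add: p poly_scale_def)
    also have "\<dots> = ?x + ?y"
      by (simp add: xy(1) polyn.scale_right_distrib sum.distrib)
    finally have b: "b = ?x + ?y" .
    have "?x \<in> N" "?y \<in> Q"
      using N Q xy by (auto intro!: polyn.subspace_sum polyn.subspace_scale)
    \<comment> \<open>\<open>?y = b - ?x\<close> lies in both \<open>N\<close> and \<open>Q\<close>,
      hence vanishes.\<close>
    moreover from this have "?y \<in> N"
      using b bN polyn.subspace_diff[OF N, of b ?x] by simp
    ultimately have "b = ?x" using b Q(2) by auto
    also have "\<dots> = (\<Sum>i\<in>UNIV. \<Sum>a\<in>C. poly_scale (p i * r i a) a)"
      by (simp add: r polyn.scale_sum_right)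
    also have "\<dots> = (\<Sum>a\<in>C. poly_scale (\<Sum>i\<in>UNIV. p i * r i a) a)"
      by (subst sum.swap) (simp add: polyn.scale_sum_left)
    finally have "b = (\<Sum>a\<in>C. poly_scale (\<Sum>i\<in>UNIV. p i * r i a) a)" .
    \<comment> \<open>The trivial expansion of \<open>b\<close>; by independence its coefficients
      agree with those just found.\<close>
    moreover have "b = (\<Sum>a\<in>C. poly_scale (if a = b then 1 else 0) a)"
      using bc assms(2) by (simp add: if_distrib if_distribR cong: if_cong)
    ultimately have "(\<Sum>a\<in>C. poly_scale ((\<Sum>i\<in>UNIV. p i * r i a) - (if a = b then 1 else 0)) a) = 0"
      by (simp only: polyn.scale_left_diff_distrib sum_subtractf) simp
    then have "(\<Sum>i\<in>UNIV. p i * r i c) - (if c = b then 1 else 0) = 0"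
      by (rule polyn.independentD[OF assms(3,2) order_refl]) (rule bc)
    moreover have "\<kappa> c b = fls_of_poly (\<Sum>i\<in>UNIV. p i * r i c)"
      by (simp add: \<kappa>_def p fls_of_poly_sum fls_of_poly_mult)
    ultimately show "\<kappa> c b = (if b = c then 1 else 0)"
      by (auto simp: fls_of_poly_1)
  qed
qed

text \<open>The dual functions read off \<open>F((X))\<close>-coordinates. A relation thus has zero
  coefficients, and a polynomial vector in the span has polynomial coordinates, so it lies in
  \<open>N\<close>.\<close>

lemma direct_summand_laurent_span:
  fixes N :: "('f::field ^ 'n) fls set"
  assumes "direct_summand N" "free_of_rank k N"
  shows "convolutional_code k (laurent.span N)" "laurent.span N \<inter> poly_vecs = N"
proof -
  obtain C where C: "finite C" "card C = k" "polyn.independent C" "polyn.span C = N"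
    using assms(2) unfolding free_of_rank_def by blast
  obtain \<kappa> where lin: "\<And>c. Vector_Spaces.linear fls_scale (*) (\<kappa> c)"
    and dual: "\<And>b c. b \<in> C \<Longrightarrow> c \<in> C \<Longrightarrow> \<kappa> c b = (if b = c then 1 else 0)"
    and poly: "\<And>c v. v \<in> poly_vecs \<Longrightarrow> \<kappa> c v \<in> range fls_of_poly"
    using direct_summand_dual_basis[OF assms(1) C(1,3,4)] by blast
  have coord: "\<kappa> c (\<Sum>b\<in>C. fls_scale (u b) b) = u c" if "c \<in> C" for u c
  proof -
    interpret Vector_Spaces.linear fls_scale "(*)" "\<kappa> c" by (rule lin)
    show ?thesis
      using that C(1) by (simp add: sum scale dual if_distrib cong: if_cong sum.cong)
  qed
  have span: "laurent.span N = laurent.span C"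
    using laurent_span_polyn_span[of C] C by simp
  have N: "N \<subseteq> poly_vecs"
  proof -
    obtain Q where "polyn.subspace Q" "{x + y |x y. x \<in> N \<and> y \<in> Q} = poly_vecs"
      using assms(1) unfolding direct_summand_def by blast
    then show ?thesis using polyn.subspace_0[of Q] by force
  qed
  have "laurent.independent C"
  proof
    assume "laurent.dependent C"
    then obtain u where "\<exists>v\<in>C. u v \<noteq> 0" "(\<Sum>v\<in>C. fls_scale (u v) v) = 0"
      by (subst (asm) laurent.dependent_finite) (auto simp: C)
    moreover have "\<kappa> c 0 = 0" for c
      using coord[of c "\<lambda>_. 0"] module_hom.zero[OF lin[unfolded linear_iff_module_hom]] by blast
    ultimately show False using coord by metis
  qed
  then show "convolutional_code k (laurent.span N)"
    unfolding convolutional_code_def span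
    using C N polyn.span_superset laurent.subspace_span by blast
  show "laurent.span N \<inter> poly_vecs = N"
  proof
    show "laurent.span N \<inter> poly_vecs \<subseteq> N"
    proof
      fix v assume v: "v \<in> laurent.span N \<inter> poly_vecs"
      then obtain u where u: "v = (\<Sum>b\<in>C. fls_scale (u b) b)"
        using span laurent.span_finite[OF C(1)] by auto
      have "\<exists>p. u c = fls_of_poly p" if "c \<in> C" for c
        using poly[of v c] coord[OF that, of u] v u by auto
      then obtain p where p: "\<And>c. c \<in> C \<Longrightarrow> u c = fls_of_poly (p c)" by metis
      have "v = (\<Sum>b\<in>C. poly_scale (p b) b)"
        using u p by (simp add: poly_scale_def)
      then show "v \<in> N"
        using C(4) polyn.span_finite[OF C(1)] by blast
    qed
    show "N \<subseteq> laurent.span N \<inter> poly_vecs"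
      using N laurent.span_superset by blast
  qed
qed


section \<open>The action of the skew Laurent series ring\<close>

locale skew_algebra_module = skew_data \<sigma> \<delta> m
  for \<sigma> \<delta> :: "'a::ring_1 \<Rightarrow> 'a" and m +
  fixes scl :: "'f::field \<Rightarrow> 'a \<Rightarrow> 'a" and ract :: "'f ^ 'n \<Rightarrow> 'a \<Rightarrow> 'f ^ 'n"
  assumes alg: "finite_dim_algebra scl"
    and lin_sigma: "Vector_Spaces.linear scl scl \<sigma>"
    and lin_delta: "Vector_Spaces.linear scl scl \<delta>"
    and ract: "right_module (*) 1 ract"
    and ract_scl: "ract v (scl c 1) = c *s v"
begin

section \<open>Scalar Laurent series inside the skew ring\<close>

sublocale scl: vector_space scl
  using alg by (simp add: finite_dim_algebra_def)

text \<open>The embedding of \<open>F((X))\<close> as a subfield of the skew Laurent series ring,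
  through \<open>c \<mapsto> scl c 1\<close>.\<close>

definition emb :: "'f fls \<Rightarrow> 'a fls" where
  "emb s = Abs_fls (\<lambda>n. scl (s $$ n) 1)"

lemma emb_nth: "emb s $$ n = scl (s $$ n) 1"
  unfolding emb_def by (rule nth_Abs_fls_ex_lower_bound) (rule exI[of _ "fls_subdegree s"], simp)

text \<open>By linearity \<sigma> fixes the scalars and \<delta> kills them, so left multiplication
  by \<open>X\<close> is a mere shift: \<open>X\<close> commutes with scalars.\<close>

lemma T_scalar: "T (\<lambda>n. scl (f n) 1) = (\<lambda>n. scl (f (n - 1)) 1)"
proof -
  interpret ls: Vector_Spaces.linear scl scl \<sigma> by (rule lin_sigma)
  interpret ld: Vector_Spaces.linear scl scl \<delta> by (rule lin_delta)
  show ?thesis by (simp add: T_def fun_eq_iff ls.scale ld.scale)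
qed

lemma U_scalar: "U (\<lambda>n. scl (f n) 1) = (\<lambda>n. scl (f (n + 1)) 1)"
  using U_T[of "\<lambda>n. scl (f (n + 1)) 1"] T_scalar[of "\<lambda>n. f (n + 1)"] by simp

lemma P_scalar: "P j (\<lambda>n. scl (f n) 1) = (\<lambda>n. scl (f (n - j)) 1)"
proof (induction j rule: int_induct[where k = 0])
  case (step1 j)
  have "n - 1 - j = n - (j + 1)" for n by simp
  then show ?case by (simp only: P_Suc step1(2) T_scalar)
next
  case (step2 j) then show ?case
    by (simp add: P_pred U_scalar[of "\<lambda>n. f (n - j)"] algebra_simps)
qed simp

lemma P_emb: "P j (fls_nth (emb s)) n = scl (s $$ (n - j)) 1"
proof -
  have "fls_nth (emb s) = (\<lambda>n. scl (s $$ n) 1)" by (rule ext) (rule emb_nth)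
  then show ?thesis by (simp only: P_scalar)
qed

text \<open>Since \<open>X\<close> commutes with scalars, restricting the skew action to the
  embedded field gives the usual vector space structure; this links codes to the skew ring.\<close>

lemma lact_emb: "lact ract v (emb s) = fls_scale s v"
proof (rule fls_eqI)
  fix n
  have "lact ract v (emb s) $$ n =
      (\<Sum>j\<in>{fls_subdegree v..n - fls_subdegree s}. ract (v $$ j) (P j (fls_nth (emb s)) n))"
    unfolding lact_nth[OF ract] by (rule E_eq[OF ract]) (auto simp: P_emb not_le)
  also have "\<dots> = (\<Sum>j\<in>{fls_subdegree v..n - fls_subdegree s}. s $$ (n - j) *s v $$ j)"
    by (simp add: P_emb ract_scl)
  also have "\<dots> = (\<Sum>i=fls_subdegree s..n - fls_subdegree v. s $$ i *s v $$ (n - i))"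
    by (rule sum.reindex_bij_witness[of _ "\<lambda>i. n - i" "\<lambda>i. n - i"]) auto
  also have "\<dots> = fls_scale s v $$ n"
    by (rule fls_scale_nth_range[symmetric]) auto
  finally show "lact ract v (emb s) $$ n = fls_scale s v $$ n" .
qed

lemma lmul_const_emb: "lact (*) (fls_const a) (emb s) $$ n = scl (s $$ n) a"
proof -
  have "lact (*) (fls_const a) (emb s) $$ n = a * scl (s $$ n) 1"
    unfolding lmul_nth by (subst E_mult_eq[of "{0}"]) (auto simp: emb_nth)
  also have "\<dots> = scl (s $$ n) a"
    using alg unfolding finite_dim_algebra_def by (metis mult.right_neutral)
  finally show ?thesis .
qed

text \<open>The coefficients of \<open>g\<close> are expanded over a finite spanning set of
  \<open>A\<close>, with constants on the left and scalar series on the right.\<close>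

lemma laurent_decomposition:
  obtains B s where "finite B" "g = (\<Sum>b\<in>B. lact (*) (fls_const b) (emb (s b)))"
proof -
  obtain B where B: "finite B" "scl.span B = UNIV"
    using alg unfolding finite_dim_algebra_def by blast
  \<comment> \<open>A spanning set may be dependent, so zero coefficients are given the zero
    expansion; this keeps every coordinate sequence zero below the subdegree of
    \<open>g\<close>.\<close>
  have "\<exists>u. g $$ n = (\<Sum>b\<in>B. scl (u b) b) \<and> (g $$ n = 0 \<longrightarrow> u = (\<lambda>_. 0))" for n
  proof (cases "g $$ n = 0")
    case False
    have "g $$ n \<in> range (\<lambda>u. \<Sum>b\<in>B. scl (u b) b)"
      using scl.span_finite[OF B(1)] B(2) by simp
    with False show ?thesis by auto
  qed simp
  then obtain u where u: "\<And>n. g $$ n = (\<Sum>b\<in>B. scl (u n b) b)"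
    "\<And>n. g $$ n = 0 \<Longrightarrow> u n = (\<lambda>_. 0)" by metis
  define s where "s b = Abs_fls (\<lambda>n. u n b)" for b
  have s: "s b $$ n = u n b" for b n
    unfolding s_def
    by (rule nth_Abs_fls_ex_lower_bound) (rule exI[of _ "fls_subdegree g"], simp add: u(2))
  have "g = (\<Sum>b\<in>B. lact (*) (fls_const b) (emb (s b)))"
    by (rule fls_eqI) (simp add: fls_nth_sum lmul_const_emb s u(1))
  then show ?thesis using that B(1) by blast
qed

text \<open>\<open>x (\<Sum>b. b s_b) = \<Sum>b. (x b) s_b\<close>, with each \<open>x b\<close> in
  \<open>N\<close> and each \<open>s_b\<close> a scalar series.\<close>

lemma lact_in_laurent_span:
  assumes N: "\<And>x a. x \<in> N \<Longrightarrow> lact ract x (fls_const a) \<in> N" and x: "x \<in> N"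
  shows "lact ract x g \<in> laurent.span N"
proof -
  interpret additive "lact ract x"
    by unfold_locales (rule lact_add_right[OF ract])
  obtain B s where "finite B" "g = (\<Sum>b\<in>B. lact (*) (fls_const b) (emb (s b)))"
    by (rule laurent_decomposition)
  then have "lact ract x g = (\<Sum>b\<in>B. fls_scale (s b) (lact ract x (fls_const b)))"
    by (simp add: sum lact_assoc[OF ract, symmetric] lact_emb)
  also have "\<dots> \<in> laurent.span N"
    by (intro laurent.span_sum laurent.span_scale laurent.span_base N x)
  finally show ?thesis .
qed

text \<open>A scalar series \<open>s\<close> need not commute with \<open>a\<close>, but
  \<open>(x s) a = x (s a)\<close> and \<open>s a\<close> is again a skew Laurent series, so
  \<open>lact_in_laurent_span\<close> applies.\<close>

lemma laurent_span_closed: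
  assumes N: "\<And>x a. x \<in> N \<Longrightarrow> lact ract x (fls_const a) \<in> N" and x: "x \<in> laurent.span N"
  shows "lact ract x (fls_const a) \<in> laurent.span N"
  using x
proof (induction rule: laurent.span_induct_alt)
  case base
  have "lact ract 0 (fls_const a) = 0"
    using lact_add_left[OF ract, of 0 0 "fls_const a"] by simp
  then show ?case by (simp add: laurent.span_zero)
next
  case (step s x y)
  have "lact ract (fls_scale s x) (fls_const a) = lact ract x (lact (*) (emb s) (fls_const a))"
    by (simp only: lact_emb[symmetric] lact_assoc[OF ract])
  then show ?case
    using lact_in_laurent_span[OF N step(1)] step(2)
    by (simp add: lact_add_left[OF ract] laurent.span_add)
qed

text \<open>\<open>(\<Sum>i. w_i X^i) p = \<Sum>i. w_i (X^i p)\<close> is a finite sum with each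
  \<open>X^i p\<close> a polynomial.\<close>

lemma lact_poly_vecs:
  assumes "v \<in> poly_vecs"
  shows "lact ract v (fls_of_poly p) \<in> poly_vecs"
proof -
  obtain w where w: "v = fls_of_poly w" using assms unfolding poly_vecs_def by blast
  let ?q = "\<lambda>i. (skew_poly_X \<sigma> \<delta> ^^ i) p"
  have *: "lact ract v (fls_of_poly p) $$ n =
      (\<Sum>i\<le>degree w. ract (coeff w i) (fls_of_poly (?q i) $$ n))" for n
  proof -
    have "lact ract v (fls_of_poly p) $$ n =
      (\<Sum>j\<in>int ` {..degree w}. ract (v $$ j) (P j (fls_nth (fls_of_poly p)) n))"
      unfolding lact_nth[OF ract]
    proof (rule E_eq[OF ract])
      fix j assume "j \<notin> int ` {..degree w}"
      then have "j < 0 \<or> nat j > degree w"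
        by (metis atMost_iff image_eqI int_nat_eq not_le)
      then show "v $$ j = 0 \<or> P j (fls_nth (fls_of_poly p)) n = 0"
        by (auto simp: w nth_fls_of_poly coeff_eq_0)
    qed simp
    then show ?thesis
      by (subst (asm) sum.reindex) (simp_all add: P_poly w nth_fls_of_poly)
  qed
  \<comment> \<open>The sum of the degrees is a convenient common bound for the degrees of all
    \<open>?q i\<close>.\<close>
  have "lact ract v (fls_of_poly p) $$ n = 0" if "n < 0 \<or> n > int (\<Sum>i\<le>degree w. degree (?q i))" for n
  proof -
    have "fls_of_poly (?q i) $$ n = 0" if i: "i \<le> degree w" for i
    proof (cases "n < 0")
      case False
      have "degree (?q i) \<le> (\<Sum>i\<le>degree w. degree (?q i))"
        using i by (intro member_le_sum) auto
      also have "\<dots> < nat n"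
        using False \<open>n < 0 \<or> _\<close> by linarith
      finally show ?thesis by (simp add: nth_fls_of_poly coeff_eq_0)
    qed (simp add: nth_fls_of_poly)
    then show ?thesis unfolding * by (simp add: r_0_right[OF ract])
  qed
  then show ?thesis
    unfolding poly_vecs_def range_fls_of_poly_iff by blast
qed

section \<open>Cyclic codes and submodules over the skew polynomial ring\<close>

lemma laurent_act_eq: "laurent_act \<sigma> \<delta> ract = lact ract"
proof -
  have "bij \<sigma>" "nilpotent_map \<delta>" "nilpotent_map (twisted_derivation \<sigma> \<delta>)"
    using bij nil nil' by (auto simp: nilpotent_map_def)
  \<comment> \<open>Uniqueness of the transferred action identifies it with the explicit
    \<open>lact ract\<close>.\<close>
  from ex1_laurent_act[OF der this alg ract ract_scl] is_laurent_act_lact[OF ract]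
  show ?thesis unfolding laurent_act_def by (intro the1_equality)
qed

text \<open>\<open>D\<close> is its own \<open>F((X))\<close>-span, so closure under constants
  already gives closure under the whole skew Laurent series ring, in particular under skew
  polynomials.\<close>

lemma cyclic_code_Int_poly_vecs:
  assumes "cyclic_code \<sigma> \<delta> ract k D"
  shows "skew_poly_submodule \<sigma> \<delta> ract (D \<inter> poly_vecs)"
proof -
  have D: "laurent.subspace D" and act: "\<And>x a. x \<in> D \<Longrightarrow> lact ract x (fls_const a) \<in> D"
    using assms unfolding cyclic_code_def convolutional_code_def right_submodule_def laurent_act_eq
    by auto
  have "lact ract x g \<in> D" if "x \<in> D" for x g
    using lact_in_laurent_span[of D, OF act that] D by (simp add: laurent.span_eq_iff[THEN iffD2])
  moreover have "polyn.subspace (D \<inter> poly_vecs)"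
    by (intro polyn.subspace_inter laurent_subspace_imp_polyn D subspace_poly_vecs)
  ultimately show ?thesis
    unfolding skew_poly_submodule_def right_submodule_def laurent_act_eq
    by (auto simp: lact_poly_vecs dest: polyn.subspace_0 polyn.subspace_add polyn.subspace_neg)
qed

text \<open>Constants are skew polynomials, so \<open>N\<close> is closed under \<open>A\<close>,
  and its span inherits this.\<close>

lemma skew_poly_submodule_laurent_span:
  assumes "skew_poly_submodule \<sigma> \<delta> ract N"
  shows "right_submodule (range fls_const) (laurent_act \<sigma> \<delta> ract) (laurent.span N)"
proof -
  have "lact ract x (fls_const a) \<in> N" if "x \<in> N" for x a
    using assms that
    unfolding skew_poly_submodule_def right_submodule_def laurent_act_eq fls_const_eq_fls_of_poly
    by blast
  then show ?thesis
    unfolding right_submodule_def laurent_act_eq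
    by (auto intro: laurent.span_zero laurent.span_add laurent.span_neg laurent_span_closed)
qed

lemma bij_betw_Int_poly_vecs:
  "bij_betw (\<lambda>D. D \<inter> poly_vecs)
    {D. cyclic_code \<sigma> \<delta> ract k D}
    {N. skew_poly_submodule \<sigma> \<delta> ract N \<and> direct_summand N \<and> free_of_rank k N}"
proof (rule bij_betw_byWitness[where f' = laurent.span])
  show "\<forall>D\<in>{D. cyclic_code \<sigma> \<delta> ract k D}. laurent.span (D \<inter> poly_vecs) = D"
    using convolutional_code_Int_poly_vecs(3) unfolding cyclic_code_def by blast
  show "\<forall>N\<in>{N. skew_poly_submodule \<sigma> \<delta> ract N \<and> direct_summand N \<and> free_of_rank k N}.
      laurent.span N \<inter> poly_vecs = N"
    using direct_summand_laurent_span(2) by blast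
  show "(\<lambda>D. D \<inter> poly_vecs) ` {D. cyclic_code \<sigma> \<delta> ract k D} \<subseteq>
      {N. skew_poly_submodule \<sigma> \<delta> ract N \<and> direct_summand N \<and> free_of_rank k N}"
    using cyclic_code_Int_poly_vecs convolutional_code_Int_poly_vecs(1,2)
    unfolding cyclic_code_def by blast
  show "laurent.span ` {N. skew_poly_submodule \<sigma> \<delta> ract N \<and> direct_summand N \<and> free_of_rank k N}
      \<subseteq> {D. cyclic_code \<sigma> \<delta> ract k D}"
    using direct_summand_laurent_span(1) skew_poly_submodule_laurent_span
    unfolding cyclic_code_def by blast
qed

end

theorem theorem4p8:
  fixes scl :: "'f::field \<Rightarrow> 'a::ring_1 \<Rightarrow> 'a"
    and \<sigma> \<delta> :: "'a \<Rightarrow> 'a"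
    and ract :: "'f ^ 'n \<Rightarrow> 'a \<Rightarrow> 'f ^ 'n"
    and k :: nat
  assumes "finite_dim_algebra scl"
    and "left_skew_derivation \<sigma> \<delta>"
    and "algebra_automorphism scl \<sigma>"
    and "Vector_Spaces.linear scl scl \<delta>"
    and "nilpotent_map \<delta>"
    and "nilpotent_map (twisted_derivation \<sigma> \<delta>)"
    and "right_module (*) 1 ract"
    and "\<And>c v. ract v (scl c 1) = c *s v"
  shows "bij_betw (\<lambda>D. D \<inter> poly_vecs)
    {D. cyclic_code \<sigma> \<delta> ract k D}
    {N. skew_poly_submodule \<sigma> \<delta> ract N \<and> direct_summand N \<and> free_of_rank k N}"
proof -
  have "bij \<sigma>" and lin: "Vector_Spaces.linear scl scl \<sigma>"
    using assms(3) by (auto simp: algebra_automorphism_def)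
  \<comment> \<open>One exponent \<open>m\<close> serves both nilpotent maps.\<close>
  then obtain m where "skew_data \<sigma> \<delta> m" using skew_data_ex assms(2,5,6) by blast
  then interpret skew_algebra_module \<sigma> \<delta> m scl ract
    using assms lin by (simp add: skew_algebra_module_def skew_algebra_module_axioms_def)
  show ?thesis by (rule bij_betw_Int_poly_vecs)
qed

end
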